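(* Let $A$ be an amenable Banach algebra with property $\mathbb{B}$, let $X$ be a Banach space, and let $\varphi\colon A\times A\to X$ be a continuous bilinear map satisfying the condition: for all $a,b\in A$, if $ab=ba=0$ then $\varphi(a,b)=0$. Then there exist continuous linear operators $\Phi\colon [A,A]\to X$ and $\Psi\colon A\to X$ such that $$\varphi(a,b)=\Phi([a,b])+\Psi(a\circ b)$$ for all $a,b\in A$.
   Context: Banach algebras (not assumed unital) and Banach spaces are over $\mathbb{C}$. For $a,b\in A$, $[a,b]=ab-ba$ and $a\circ b=ab+ba$. $[A,A]$ denotes the linear span of all commutators $[a,b]$ ($a,b\in A$), with the norm inherited from $A$. Property $\mathbb{B}$: a Banach algebra $A$ has property $\mathbb{B}$ if for every continuous bilinear functional $\varphi\colon A\times A\to\mathbb{C}$, the condition "for all $a,b\in A$, $ab=0$ implies $\varphi(a,b)=0$" implies the condition "$\varphi(ab,c)=\varphi(a,bc)$ for all $a,b,c\in A$". Amenability: the projective tensor product $A\widehat{\otimes}A$ is a Banach $A$-bimodule with $a\cdot(b\otimes c)=(ab)\otimes c$ and $(b\otimes c)\cdot a=b\otimes(ca)$, and $\pi\colon A\widehat{\otimes}A\to A$ is the unique continuous linear map with $\pi(a\otimes b)=ab$. An approximate diagonal for $A$ is a bounded net $(u_\lambda)_{\lambda\in\Lambda}$ in $A\widehat{\otimes}A$ such that for each $a\in A$, $\lim_\lambda(a\cdot u_\lambda-u_\lambda\cdot a)=0$ and $\lim_\lambda\pi(u_\lambda)a=a$. $A$ is amenable if and only if it has an approximate diagonal. 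*)

theory Defs
  imports "HOL-Analysis.Analysis" "HOL-Library.Multiset"
begin

section \<open>Complex Banach spaces and Banach algebras\<close>

class complex_vector = real_vector +
  fixes scaleC :: "complex \<Rightarrow> 'a \<Rightarrow> 'a"  (infixr "*\<^sub>C" 75)
  assumes scaleC_add_right: "c *\<^sub>C (x + y) = c *\<^sub>C x + c *\<^sub>C y"
    and scaleC_add_left: "(c + d) *\<^sub>C x = c *\<^sub>C x + d *\<^sub>C x"
    and scaleC_scaleC: "c *\<^sub>C d *\<^sub>C x = (c * d) *\<^sub>C x"
    and scaleC_one: "1 *\<^sub>C x = x"
    and scaleR_scaleC: "r *\<^sub>R x = complex_of_real r *\<^sub>C x"

class complex_normed_vector = complex_vector + real_normed_vector +
  assumes norm_scaleC: "norm (c *\<^sub>C x) = cmod c * norm x"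

class complex_banach = complex_normed_vector + complete_space

subclass (in complex_banach) banach ..

class complex_banach_algebra = complex_banach + real_normed_algebra +
  assumes mult_scaleC_left: "(c *\<^sub>C x) * y = c *\<^sub>C (x * y)"
    and mult_scaleC_right: "x * (c *\<^sub>C y) = c *\<^sub>C (x * y)"

instantiation complex :: complex_banach_algebra
begin

definition scaleC_complex :: "complex \<Rightarrow> complex \<Rightarrow> complex" where
  "scaleC_complex c z = c * z"

instance
  by standard (simp_all add: scaleC_complex_def algebra_simps scaleR_conv_of_real norm_mult)

end

interpretation complex_vector: vector_space "scaleC :: complex \<Rightarrow> 'a \<Rightarrow> 'a::complex_vector"
  by standard (simp_all add: scaleC_add_right scaleC_add_left scaleC_scaleC scaleC_one)

definition continuous_clinear_on ::
    "'a::complex_normed_vector set \<Rightarrow> ('a \<Rightarrow> 'b::complex_normed_vector) \<Rightarrow> bool" where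
  "continuous_clinear_on S f \<longleftrightarrow>
     (\<forall>x\<in>S. \<forall>y\<in>S. f (x + y) = f x + f y) \<and>
     (\<forall>c. \<forall>x\<in>S. f (c *\<^sub>C x) = c *\<^sub>C f x) \<and>
     continuous_on S f"

definition cbilinear :: "('a::complex_vector \<Rightarrow> 'b::complex_vector \<Rightarrow> 'c::complex_vector) \<Rightarrow> bool" where
  "cbilinear f \<longleftrightarrow>
     (\<forall>a a' b. f (a + a') b = f a b + f a' b) \<and>
     (\<forall>a b b'. f a (b + b') = f a b + f a b') \<and>
     (\<forall>c a b. f (c *\<^sub>C a) b = c *\<^sub>C f a b) \<and>
     (\<forall>c a b. f a (c *\<^sub>C b) = c *\<^sub>C f a b)"

definition continuous_cbilinear ::
    "('a::complex_normed_vector \<Rightarrow> 'b::complex_normed_vector \<Rightarrow> 'c::complex_normed_vector) \<Rightarrow> bool" where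
  "continuous_cbilinear f \<longleftrightarrow> cbilinear f \<and> continuous_on UNIV (\<lambda>(a, b). f a b)"

lemma cbilinear_zero:
  assumes "cbilinear f"
  shows "f 0 b = 0" "f a 0 = 0"
proof -
  have "f (0 + 0) b = f 0 b + f 0 b" "f a (0 + 0) = f a 0 + f a 0"
    using assms unfolding cbilinear_def by blast+
  then show "f 0 b = 0" "f a 0 = 0" by simp_all
qed

lemma cbilinearD:
  assumes "cbilinear f"
  shows "f (a + a') b = f a b + f a' b" "f a (b + b') = f a b + f a b'"
    and "f (c *\<^sub>C a) b = c *\<^sub>C f a b" "f a (c *\<^sub>C b) = c *\<^sub>C f a b"
  using assms unfolding cbilinear_def by blast+

lemma cbilinear_scaleR:
  assumes "cbilinear f"
  shows "f (r *\<^sub>R a) b = r *\<^sub>R f a b" "f a (r *\<^sub>R b) = r *\<^sub>R f a b"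
  using assms unfolding cbilinear_def scaleR_scaleC by blast+

lemma continuous_cbilinear_bounded:
  assumes "continuous_cbilinear f"
  shows "\<exists>K\<ge>0. \<forall>a b. norm (f a b) \<le> K * (norm a * norm b)"
proof -
  have f: "cbilinear f" and c: "continuous_on UNIV (\<lambda>(a, b). f a b)"
    using assms by (auto simp: continuous_cbilinear_def)
  have "continuous (at (0, 0)) (\<lambda>(a, b). f a b)"
    using c by (simp add: continuous_on_eq_continuous_at)
  from this[unfolded continuous_at_eps_delta, rule_format, OF zero_less_one]
  obtain d where d: "d > 0"
    "\<And>p. dist p (0, 0) < d \<Longrightarrow> dist ((\<lambda>(a, b). f a b) p) ((\<lambda>(a, b). f a b) (0, 0)) < 1"
    by auto
  have small: "norm (f a b) \<le> 1" if "norm a \<le> d/3" "norm b \<le> d/3" for a b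
  proof -
    have "norm (a, b) \<le> norm a + norm b" by (simp add: norm_Pair_le)
    also have "\<dots> < d" using that d(1) by linarith
    finally have "dist (a, b) (0, 0) < d" by (simp add: dist_norm)
    from d(2)[OF this] show ?thesis by (simp add: cbilinear_zero[OF f] dist_norm)
  qed
  define K where "K = (3/d)^2"
  have "norm (f a b) \<le> K * (norm a * norm b)" for a b
  proof (cases "a = 0 \<or> b = 0")
    case True
    then show ?thesis by (auto simp: cbilinear_zero[OF f])
  next
    case False
    define s t where "s = d / (3 * norm a)" and "t = d / (3 * norm b)"
    have st: "s > 0" "t > 0" using False d(1) by (auto simp: s_def t_def)
    have "norm (f (s *\<^sub>R a) (t *\<^sub>R b)) \<le> 1"
      using st False d(1) by (intro small) (auto simp: s_def t_def)
    then have "s * t * norm (f a b) \<le> 1"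
      using st by (simp add: cbilinear_scaleR[OF f] abs_mult mult_ac)
    then have "norm (f a b) \<le> 1 / (s * t)"
      using st by (simp add: field_simps)
    also have "\<dots> = K * (norm a * norm b)"
      using False d(1) by (simp add: s_def t_def K_def field_simps power2_eq_square)
    finally show ?thesis .
  qed
  moreover have "K \<ge> 0" by (simp add: K_def)
  ultimately show ?thesis by blast
qed

lemma bounded_imp_continuous_cbilinear:
  assumes f: "cbilinear f" and K: "\<And>a b. norm (f a b) \<le> K * (norm a * norm b)"
  shows "continuous_cbilinear f"
proof -
  have "bounded_bilinear f"
  proof
    show "\<exists>K. \<forall>a b. norm (f a b) \<le> norm a * norm b * K"
      using K by (intro exI[of _ K]) (simp add: mult_ac)
    show "f (a + a') b = f a b + f a' b" "f a (b + b') = f a b + f a b'" for a a' b b'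
      using f unfolding cbilinear_def by blast+
    show "f (r *\<^sub>R a) b = r *\<^sub>R f a b" "f a (r *\<^sub>R b) = r *\<^sub>R f a b" for r a b
      by (rule cbilinear_scaleR[OF f])+
  qed
  then have "continuous_on UNIV (\<lambda>p. f (fst p) (snd p))"
    by (rule bounded_bilinear.continuous_on) (intro continuous_intros)+
  then show ?thesis using f by (simp add: continuous_cbilinear_def case_prod_beta)
qed

lemma continuous_clinear_bounded:
  assumes "continuous_clinear_on UNIV f"
  obtains K where "K \<ge> 0" "\<And>x. norm (f x) \<le> K * norm x"
proof -
  have f: "linear f"
  proof
    show "f (x + y) = f x + f y" for x y
      using assms unfolding continuous_clinear_on_def by blast
    show "f (r *\<^sub>R x) = r *\<^sub>R f x" for r x
    proof -
      have "f (complex_of_real r *\<^sub>C x) = complex_of_real r *\<^sub>C f x"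
        using assms unfolding continuous_clinear_on_def by blast
      then show ?thesis unfolding scaleR_scaleC[of r x] scaleR_scaleC[of r "f x"] .
    qed
  qed
  have "continuous (at 0) f"
    using assms unfolding continuous_clinear_on_def
    by (metis continuous_on_eq_continuous_at open_UNIV UNIV_I)
  from this[unfolded continuous_at_eps_delta, rule_format, OF zero_less_one]
  obtain d where d: "d > 0" "\<And>x. dist x 0 < d \<Longrightarrow> dist (f x) (f 0) < 1"
    by auto
  have "norm (f x) \<le> (2/d) * norm x" for x
  proof (cases "x = 0")
    case True
    then show ?thesis using linear_0[OF f] by simp
  next
    case False
    define s where "s = d / (2 * norm x)"
    have s: "s > 0" using False d(1) by (simp add: s_def)
    have "norm (s *\<^sub>R x) < d" using False d(1) s by (simp add: s_def)
    then have "norm (f (s *\<^sub>R x)) < 1"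
      using d(2)[of "s *\<^sub>R x"] by (simp add: linear_0[OF f] del: norm_scaleR)
    then have "s * norm (f x) < 1" using s by (simp add: linear_scale[OF f])
    then have "norm (f x) < 1 / s" using s by (simp add: pos_less_divide_eq mult.commute)
    also have "1 / s = (2/d) * norm x" using False d(1) by (simp add: s_def)
    finally show ?thesis by simp
  qed
  moreover have "2/d \<ge> 0" using d(1) by simp
  ultimately show ?thesis using that by blast
qed


section \<open>The algebraic tensor product\<close>

text \<open>A multiset of pairs stands for the formal sum of the elementary tensors of its members.
  Scalars are absorbed into the first factor, so the generators need no coefficients.  In a
  commutative monoid the last relation does not follow from the others.\<close>

inductive tensor_eq ::
    "('a::complex_vector \<times> 'b::complex_vector) multiset \<Rightarrow> ('a \<times> 'b) multiset \<Rightarrow> bool" where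
  refl: "tensor_eq M M"
| sym: "tensor_eq M N \<Longrightarrow> tensor_eq N M"
| trans: "tensor_eq M N \<Longrightarrow> tensor_eq N P \<Longrightarrow> tensor_eq M P"
| plus: "tensor_eq M N \<Longrightarrow> tensor_eq (M + P) (N + P)"
| add_left: "tensor_eq {#(a + a', b)#} {#(a, b), (a', b)#}"
| add_right: "tensor_eq {#(a, b + b')#} {#(a, b), (a, b')#}"
| scale: "tensor_eq {#(c *\<^sub>C a, b)#} {#(a, c *\<^sub>C b)#}"
| zero: "tensor_eq {#(0, b)#} {#}"

quotient_type (overloaded) ('a, 'b) atensor =
    "('a::complex_vector \<times> 'b::complex_vector) multiset" / tensor_eq
  by (intro equivpI reflpI sympI transpI)
    (fact tensor_eq.refl, erule tensor_eq.sym, erule (1) tensor_eq.trans)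

lemma tensor_eq_plus2: "tensor_eq M N \<Longrightarrow> tensor_eq P Q \<Longrightarrow> tensor_eq (M + P) (N + Q)"
  using tensor_eq.trans[OF tensor_eq.plus, of M N P "N + Q"] tensor_eq.plus[of P Q N]
  by (simp add: add.commute)

lemma tensor_eq_scale_image:
  assumes "tensor_eq M N"
  shows "tensor_eq (image_mset (\<lambda>(a, b). (c *\<^sub>C a, b)) M) (image_mset (\<lambda>(a, b). (c *\<^sub>C a, b)) N)"
  using assms
proof induction
  case (scale d a b)
  then show ?case
    using tensor_eq.scale[of d "c *\<^sub>C a" b] by (simp add: scaleC_scaleC mult.commute)
next
  case (sym M N)
  show ?case by (rule tensor_eq.sym[OF sym.IH])
next
  case (trans M N P)
  show ?case by (rule tensor_eq.trans[OF trans.IH])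
qed (simp_all add: tensor_eq.refl tensor_eq.plus tensor_eq.add_left tensor_eq.add_right tensor_eq.zero
    scaleC_add_right)

lemma tensor_eq_scale_add:
  "tensor_eq (image_mset (\<lambda>(a, b). ((c + d) *\<^sub>C a, b)) M)
     (image_mset (\<lambda>(a, b). (c *\<^sub>C a, b)) M + image_mset (\<lambda>(a, b). (d *\<^sub>C a, b)) M)"
proof (induction M)
  case empty
  then show ?case by (simp add: tensor_eq.refl)
next
  case (add p M)
  obtain a b where p: "p = (a, b)" by (cases p)
  have "tensor_eq {#((c + d) *\<^sub>C a, b)#} {#(c *\<^sub>C a, b), (d *\<^sub>C a, b)#}"
    unfolding scaleC_add_left by (rule tensor_eq.add_left)
  from tensor_eq_plus2[OF this add] show ?case by (simp add: p add_mset_commute)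
qed

lemma tensor_eq_scale_zero: "tensor_eq (image_mset (\<lambda>(a, b). (0 *\<^sub>C a, b)) M) {#}"
proof (induction M)
  case empty
  then show ?case by (simp add: tensor_eq.refl)
next
  case (add p M)
  obtain a b where p: "p = (a, b)" by (cases p)
  show ?case
    using tensor_eq_plus2[OF tensor_eq.zero[of b] add] by (simp add: p)
qed

instantiation atensor :: (complex_vector, complex_vector) complex_vector
begin

lift_definition zero_atensor :: "('a, 'b) atensor" is "{#}" .
lift_definition plus_atensor :: "('a, 'b) atensor \<Rightarrow> ('a, 'b) atensor \<Rightarrow> ('a, 'b) atensor"
  is "(+)" by (rule tensor_eq_plus2)
lift_definition scaleC_atensor :: "complex \<Rightarrow> ('a, 'b) atensor \<Rightarrow> ('a, 'b) atensor"
  is "\<lambda>c. image_mset (\<lambda>(a, b). (c *\<^sub>C a, b))" by (rule tensor_eq_scale_image)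
definition uminus_atensor :: "('a, 'b) atensor \<Rightarrow> ('a, 'b) atensor" where
  "uminus_atensor x = (-1) *\<^sub>C x"
definition minus_atensor :: "('a, 'b) atensor \<Rightarrow> ('a, 'b) atensor \<Rightarrow> ('a, 'b) atensor" where
  "minus_atensor x y = x + (-1) *\<^sub>C y"
definition scaleR_atensor :: "real \<Rightarrow> ('a, 'b) atensor \<Rightarrow> ('a, 'b) atensor" where
  "scaleR_atensor r x = complex_of_real r *\<^sub>C x"

instance
proof
  fix x y z :: "('a, 'b) atensor" and c d :: complex and r s :: real
  show assoc: "x + y + z = x + (y + z)"
    by transfer (simp add: add.assoc tensor_eq.refl)
  show comm: "x + y = y + x"
    by transfer (simp add: add.commute tensor_eq.refl)
  show z: "0 + x = x"
    by transfer (simp add: tensor_eq.refl)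
  have addr: "c *\<^sub>C (x + y) = c *\<^sub>C x + c *\<^sub>C y" for c and x y :: "('a, 'b) atensor"
    by transfer (simp add: tensor_eq.refl)
  have addl: "(c + d) *\<^sub>C x = c *\<^sub>C x + d *\<^sub>C x" for c d and x :: "('a, 'b) atensor"
    by transfer (rule tensor_eq_scale_add)
  have scsc: "c *\<^sub>C d *\<^sub>C x = (c * d) *\<^sub>C x" for c d and x :: "('a, 'b) atensor"
    by transfer (simp add: multiset.map_comp o_def split_def scaleC_scaleC tensor_eq.refl)
  have one: "1 *\<^sub>C x = x" for x :: "('a, 'b) atensor"
    by transfer (simp add: scaleC_one tensor_eq.refl)
  have zer: "0 *\<^sub>C x = 0" for x :: "('a, 'b) atensor"
    by transfer (rule tensor_eq_scale_zero)
  show "c *\<^sub>C (x + y) = c *\<^sub>C x + c *\<^sub>C y" by (rule addr)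
  show "(c + d) *\<^sub>C x = c *\<^sub>C x + d *\<^sub>C x" by (rule addl)
  show "c *\<^sub>C d *\<^sub>C x = (c * d) *\<^sub>C x" by (rule scsc)
  show "1 *\<^sub>C x = x" by (rule one)
  have "(-1) *\<^sub>C x + 1 *\<^sub>C x = 0"
    by (simp add: zer flip: addl)
  then show "- x + x = 0" by (simp add: one uminus_atensor_def)
  show "x - y = x + - y" by (simp add: uminus_atensor_def minus_atensor_def)
  show "r *\<^sub>R x = complex_of_real r *\<^sub>C x" by (simp add: scaleR_atensor_def)
  show "r *\<^sub>R (x + y) = r *\<^sub>R x + r *\<^sub>R y" by (simp add: scaleR_atensor_def addr)
  show "(r + s) *\<^sub>R x = r *\<^sub>R x + s *\<^sub>R x" by (simp add: scaleR_atensor_def addl)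
  show "r *\<^sub>R s *\<^sub>R x = (r * s) *\<^sub>R x" by (simp add: scaleR_atensor_def scsc)
  show "1 *\<^sub>R x = x" by (simp add: scaleR_atensor_def one)
qed

end

lift_definition atens :: "'a::complex_vector \<Rightarrow> 'b::complex_vector \<Rightarrow> ('a, 'b) atensor"
  is "\<lambda>a b. {#(a, b)#}" .

lemma cbilinear_atens: "cbilinear atens"
proof -
  have sl: "atens (c *\<^sub>C a) b = c *\<^sub>C atens a b" for c and a :: 'a and b :: 'b
    by transfer (simp add: tensor_eq.refl)
  have sr: "atens a (c *\<^sub>C b) = atens (c *\<^sub>C a) b" for c and a :: 'a and b :: 'b
    by transfer (rule tensor_eq.sym[OF tensor_eq.scale])
  have al: "atens (a + a') b = atens a b + atens a' b" for a a' :: 'a and b :: 'b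
    by transfer (use tensor_eq.add_left in \<open>force simp: add_mset_commute\<close>)
  have ar: "atens a (b + b') = atens a b + atens a b'" for a :: 'a and b b' :: 'b
    by transfer (use tensor_eq.add_right in \<open>force simp: add_mset_commute\<close>)
  show ?thesis unfolding cbilinear_def using sl sr al ar by metis
qed

lemma abs_atensor_eq_sum: "abs_atensor M = (\<Sum>(a, b)\<in>#M. atens a b)"
proof (induction M)
  case empty
  then show ?case by (simp add: zero_atensor.abs_eq)
next
  case (add p M)
  have "abs_atensor (add_mset p M) = abs_atensor {#p#} + abs_atensor M"
    by (simp add: plus_atensor.abs_eq)
  also have "abs_atensor {#p#} = atens (fst p) (snd p)"
    by (simp add: atens.abs_eq)
  finally show ?case by (simp add: add case_prod_beta)
qed

lemma atensor_eq_sum: obtains M where "x = (\<Sum>(a, b)\<in>#M. atens a b)"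
  by (metis abs_atensor_eq_sum Quotient3_abs_rep Quotient3_atensor)

definition atensor_lift ::
    "('a::complex_vector \<Rightarrow> 'b::complex_vector \<Rightarrow> 'c::complex_vector) \<Rightarrow> ('a, 'b) atensor \<Rightarrow> 'c" where
  "atensor_lift f x = (\<Sum>(a, b)\<in>#rep_atensor x. f a b)"

lemma tensor_eq_sum:
  assumes f: "cbilinear f" and "tensor_eq M N"
  shows "(\<Sum>(a, b)\<in>#M. f a b) = (\<Sum>(a, b)\<in>#N. f a b)"
  using assms(2) by induction (simp_all add: cbilinear_zero[OF f] cbilinearD[OF f])

lemma atensor_lift_abs:
  assumes f: "cbilinear f"
  shows "atensor_lift f (abs_atensor M) = (\<Sum>(a, b)\<in>#M. f a b)"
  unfolding atensor_lift_def
  by (rule tensor_eq_sum[OF f]) (rule Quotient3_rep_abs[OF Quotient3_atensor tensor_eq.refl])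

lemma atensor_lift_props:
  assumes f: "cbilinear f"
  shows "atensor_lift f (x + y) = atensor_lift f x + atensor_lift f y"
    and "atensor_lift f (c *\<^sub>C x) = c *\<^sub>C atensor_lift f x"
    and "atensor_lift f (atens a b) = f a b"
proof -
  obtain M N where xy: "x = abs_atensor M" "y = abs_atensor N"
    by (metis Quotient3_abs_rep Quotient3_atensor)
  show "atensor_lift f (x + y) = atensor_lift f x + atensor_lift f y"
    by (simp add: xy plus_atensor.abs_eq atensor_lift_abs[OF f])
  have "(\<Sum>(a, b)\<in>#M. f (c *\<^sub>C a) b) = c *\<^sub>C (\<Sum>(a, b)\<in>#M. f a b)"
  proof (induction M)
    case (add p M)
    have "f (c *\<^sub>C fst p) (snd p) = c *\<^sub>C f (fst p) (snd p)"
      by (rule cbilinearD[OF f])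
    with add show ?case by (simp add: scaleC_add_right case_prod_beta)
  qed simp
  then show "atensor_lift f (c *\<^sub>C x) = c *\<^sub>C atensor_lift f x"
    by (simp add: xy scaleC_atensor.abs_eq atensor_lift_abs[OF f] multiset.map_comp o_def split_def)
  show "atensor_lift f (atens a b) = f a b"
    by (simp add: atens.abs_eq atensor_lift_abs[OF f])
qed

section \<open>The projective norm\<close>

definition proj_norm :: "('a::complex_normed_vector, 'b::complex_normed_vector) atensor \<Rightarrow> real" where
  "proj_norm x = Inf {(\<Sum>(a, b)\<in>#M. norm a * norm b) | M. x = (\<Sum>(a, b)\<in>#M. atens a b)}"

lemma sum_mset_norm_nonneg: "0 \<le> (\<Sum>(a, b)\<in>#M. norm a * norm b)"
  by (induction M) auto

lemma proj_norm_le: "proj_norm (\<Sum>(a, b)\<in>#M. atens a b) \<le> (\<Sum>(a, b)\<in>#M. norm a * norm b)"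
proof -
  have "bdd_below {(\<Sum>(a, b)\<in>#N. norm a * norm b) | N.
      (\<Sum>(a, b)\<in>#M. atens a b) = (\<Sum>(a, b)\<in>#N. atens a b)}"
    by (rule bdd_belowI[of _ 0]) (auto intro!: sum_mset_norm_nonneg)
  then show ?thesis unfolding proj_norm_def by (intro cInf_lower) auto
qed

lemma proj_norm_ge:
  assumes "\<And>M. x = (\<Sum>(a, b)\<in>#M. atens a b) \<Longrightarrow> B \<le> (\<Sum>(a, b)\<in>#M. norm a * norm b)"
  shows "B \<le> proj_norm x"
  unfolding proj_norm_def by (rule cInf_greatest) (use assms atensor_eq_sum in blast)+

lemma proj_norm_nonneg: "0 \<le> proj_norm x"
  by (rule proj_norm_ge) (auto intro!: sum_mset_norm_nonneg)

lemma proj_norm_atens: "proj_norm (atens a b) \<le> norm a * norm b"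
  using proj_norm_le[of "{#(a, b)#}"] by simp

lemma proj_norm_approx:
  assumes "e > 0"
  obtains M where "x = (\<Sum>(a, b)\<in>#M. atens a b)" "(\<Sum>(a, b)\<in>#M. norm a * norm b) < proj_norm x + e"
proof -
  have "\<exists>M. x = (\<Sum>(a, b)\<in>#M. atens a b) \<and> (\<Sum>(a, b)\<in>#M. norm a * norm b) < proj_norm x + e"
  proof (rule ccontr)
    assume "\<not> ?thesis"
    then have "proj_norm x + e \<le> proj_norm x" by (intro proj_norm_ge) force
    then show False using assms by simp
  qed
  then show ?thesis using that by blast
qed

lemma proj_norm_triangle: "proj_norm (x + y) \<le> proj_norm x + proj_norm y"
proof (rule field_le_epsilon)
  fix e :: real assume "e > 0"
  then have e: "e/2 > 0" by simp
  obtain M where M: "x = (\<Sum>(a, b)\<in>#M. atens a b)" "(\<Sum>(a, b)\<in>#M. norm a * norm b) < proj_norm x + e/2"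
    by (rule proj_norm_approx[OF e])
  obtain N where N: "y = (\<Sum>(a, b)\<in>#N. atens a b)" "(\<Sum>(a, b)\<in>#N. norm a * norm b) < proj_norm y + e/2"
    by (rule proj_norm_approx[OF e])
  show "proj_norm (x + y) \<le> proj_norm x + proj_norm y + e"
    using proj_norm_le[of "M + N"] M N by simp
qed

lemma proj_norm_zero [simp]: "proj_norm 0 = 0"
  by (rule antisym[OF _ proj_norm_nonneg]) (use proj_norm_le[of "{#}"] in simp)

lemma proj_norm_scaleC_le: "proj_norm (c *\<^sub>C x) \<le> cmod c * proj_norm x"
proof (rule field_le_epsilon)
  fix e :: real assume "e > 0"
  then have e: "e / (cmod c + 1) > 0" by (simp add: add_nonneg_pos)
  obtain M where M: "x = (\<Sum>(a, b)\<in>#M. atens a b)"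
    "(\<Sum>(a, b)\<in>#M. norm a * norm b) < proj_norm x + e / (cmod c + 1)"
    by (rule proj_norm_approx[OF e])
  define N where "N = image_mset (\<lambda>(a, b). (c *\<^sub>C a, b)) M"
  have "c *\<^sub>C x = (\<Sum>(a, b)\<in>#N. atens a b)"
    unfolding M(1) N_def
    by (induction M) (auto simp: scaleC_add_right cbilinearD[OF cbilinear_atens])
  moreover have "(\<Sum>(a, b)\<in>#N. norm a * norm b) = cmod c * (\<Sum>(a, b)\<in>#M. norm a * norm b)"
    unfolding N_def by (induction M) (auto simp: norm_scaleC algebra_simps)
  ultimately have "proj_norm (c *\<^sub>C x) \<le> cmod c * (\<Sum>(a, b)\<in>#M. norm a * norm b)"
    using proj_norm_le[of N] by simp
  also have "\<dots> \<le> cmod c * (proj_norm x + e / (cmod c + 1))"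
    using M(2) by (intro mult_left_mono) auto
  also have "\<dots> = cmod c * proj_norm x + e * (cmod c / (cmod c + 1))"
    by (simp add: algebra_simps)
  also have "\<dots> \<le> cmod c * proj_norm x + e"
    using \<open>e > 0\<close> by (intro add_left_mono mult_left_le) (auto simp: divide_simps add_nonneg_pos)
  finally show "proj_norm (c *\<^sub>C x) \<le> cmod c * proj_norm x + e" .
qed

lemma proj_norm_scaleC: "proj_norm (c *\<^sub>C x) = cmod c * proj_norm x"
proof (cases "c = 0")
  case True
  then show ?thesis by simp
next
  case False
  have "proj_norm x = proj_norm (inverse c *\<^sub>C c *\<^sub>C x)"
    using False by (simp add: scaleC_scaleC scaleC_one)
  also have "\<dots> \<le> inverse (cmod c) * proj_norm (c *\<^sub>C x)"
    using proj_norm_scaleC_le[of "inverse c" "c *\<^sub>C x"] by (simp only: norm_inverse)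
  finally have "cmod c * proj_norm x \<le> proj_norm (c *\<^sub>C x)"
    using False by (simp add: field_simps)
  then show ?thesis using proj_norm_scaleC_le[of c x] by simp
qed

lemma proj_norm_minus: "proj_norm (- x) = proj_norm x"
  using proj_norm_scaleC[of "-1" x] by simp

lemma proj_norm_minus_commute: "proj_norm (x - y) = proj_norm (y - x)"
  using proj_norm_minus[of "x - y"] by simp

lemma proj_norm_diff_triangle: "proj_norm (x - z) \<le> proj_norm (x - y) + proj_norm (y - z)"
  using proj_norm_triangle[of "x - y" "y - z"] by simp

lemma proj_norm_abs_diff: "\<bar>proj_norm x - proj_norm y\<bar> \<le> proj_norm (x - y)"
  using proj_norm_triangle[of "x - y" y] proj_norm_triangle[of "y - x" x] proj_norm_minus_commute[of x y]
  by simp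

lemma atensor_lift_bounded:
  fixes f :: "'a::complex_normed_vector \<Rightarrow> 'b::complex_normed_vector \<Rightarrow> 'c::complex_normed_vector"
  assumes f: "cbilinear f" and "K \<ge> 0" "\<And>a b. norm (f a b) \<le> K * (norm a * norm b)"
  shows "norm (atensor_lift f x) \<le> K * proj_norm x"
proof -
  have *: "norm (atensor_lift f x) \<le> K * (\<Sum>(a, b)\<in>#M. norm a * norm b)"
    if "x = (\<Sum>(a, b)\<in>#M. atens a b)" for M
  proof -
    have "atensor_lift f x = (\<Sum>(a, b)\<in>#M. f a b)"
      by (simp add: that atensor_lift_abs[OF f] flip: abs_atensor_eq_sum)
    moreover have "norm (\<Sum>(a, b)\<in>#M. f a b) \<le> K * (\<Sum>(a, b)\<in>#M. norm a * norm b)"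
    proof (induction M)
      case (add p M)
      then show ?case
        using norm_triangle_ineq[of "f (fst p) (snd p)" "\<Sum>(a, b)\<in>#M. f a b"]
          assms(3)[of "fst p" "snd p"]
        by (simp add: split_def distrib_left)
    qed simp
    ultimately show ?thesis by simp
  qed
  show ?thesis
  proof (rule field_le_epsilon)
    fix e :: real assume "e > 0"
    then have e: "e / (K + 1) > 0" using assms(2) by simp
    obtain M where M: "x = (\<Sum>(a, b)\<in>#M. atens a b)"
      "(\<Sum>(a, b)\<in>#M. norm a * norm b) < proj_norm x + e / (K + 1)"
      by (rule proj_norm_approx[OF e])
    have "norm (atensor_lift f x) \<le> K * (proj_norm x + e / (K + 1))"
      using *[OF M(1)] M(2) assms(2) by (meson less_imp_le mult_left_mono order_trans)
    also have "\<dots> = K * proj_norm x + e * (K / (K + 1))" by (simp add: algebra_simps)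
    also have "\<dots> \<le> K * proj_norm x + e"
      using \<open>e > 0\<close> assms(2) by (intro add_left_mono mult_left_le) (auto simp: divide_simps)
    finally show "norm (atensor_lift f x) \<le> K * proj_norm x + e" .
  qed
qed

section \<open>The projective tensor product\<close>

text \<open>The completion of the algebraic tensor product: Cauchy sequences modulo null sequences.
  That \<open>proj_norm\<close> is definite (a norm, not only a seminorm) is not needed for this.\<close>

definition proj_Cauchy ::
    "(nat \<Rightarrow> ('a::complex_normed_vector, 'b::complex_normed_vector) atensor) \<Rightarrow> bool" where
  "proj_Cauchy s \<longleftrightarrow> (\<forall>e>0. \<exists>N. \<forall>m\<ge>N. \<forall>n\<ge>N. proj_norm (s m - s n) < e)"

definition proj_equiv ::
    "(nat \<Rightarrow> ('a::complex_normed_vector, 'b::complex_normed_vector) atensor) \<Rightarrow>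
     (nat \<Rightarrow> ('a, 'b) atensor) \<Rightarrow> bool" where
  "proj_equiv s t \<longleftrightarrow> proj_Cauchy s \<and> proj_Cauchy t \<and> (\<lambda>n. proj_norm (s n - t n)) \<longlonglongrightarrow> 0"

lemma proj_Cauchy_const: "proj_Cauchy (\<lambda>_. x)"
  by (simp add: proj_Cauchy_def)

lemma proj_equiv_refl: "proj_equiv s s \<longleftrightarrow> proj_Cauchy s"
  by (simp add: proj_equiv_def)

lemma proj_null_le:
  assumes "\<And>n. proj_norm (s n) \<le> g n" "g \<longlonglongrightarrow> 0"
  shows "(\<lambda>n. proj_norm (s n)) \<longlonglongrightarrow> 0"
  by (rule tendsto_sandwich[OF _ _ tendsto_const assms(2)])
    (auto simp: proj_norm_nonneg assms(1))

lemma part_equivp_proj_equiv: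
  "part_equivp (proj_equiv ::
     (nat \<Rightarrow> ('a::complex_normed_vector, 'b::complex_normed_vector) atensor) \<Rightarrow> _)"
  (is "part_equivp ?R")
proof (rule part_equivpI)
  show "\<exists>s :: nat \<Rightarrow> ('a, 'b) atensor. proj_equiv s s"
    using proj_equiv_refl proj_Cauchy_const by blast
  show "symp ?R"
    by (rule sympI) (auto simp: proj_equiv_def proj_norm_minus_commute)
  show "transp ?R"
  proof (rule transpI)
    fix s t u :: "nat \<Rightarrow> ('a, 'b) atensor"
    assume st: "proj_equiv s t" and tu: "proj_equiv t u"
    have "(\<lambda>n. proj_norm (s n - t n) + proj_norm (t n - u n)) \<longlonglongrightarrow> 0 + 0"
      using st tu unfolding proj_equiv_def by (intro tendsto_add) auto
    then have "(\<lambda>n. proj_norm (s n - u n)) \<longlonglongrightarrow> 0"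
      by (intro proj_null_le[OF proj_norm_diff_triangle]) simp
    then show "proj_equiv s u" using st tu by (auto simp: proj_equiv_def)
  qed
qed

quotient_type (overloaded) ('a, 'b) ptensor =
    "nat \<Rightarrow> ('a::complex_normed_vector, 'b::complex_normed_vector) atensor" / partial: proj_equiv
  by (rule part_equivp_proj_equiv)

lemma proj_Cauchy_add:
  assumes "proj_Cauchy s" "proj_Cauchy t"
  shows "proj_Cauchy (\<lambda>n. s n + t n)"
  unfolding proj_Cauchy_def
proof (intro allI impI)
  fix e :: real assume "e > 0"
  then have "e/2 > 0" by simp
  obtain N where N: "\<And>m n. m \<ge> N \<Longrightarrow> n \<ge> N \<Longrightarrow> proj_norm (s m - s n) < e/2"
    using assms(1) \<open>e/2 > 0\<close> unfolding proj_Cauchy_def by meson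
  obtain N' where N': "\<And>m n. m \<ge> N' \<Longrightarrow> n \<ge> N' \<Longrightarrow> proj_norm (t m - t n) < e/2"
    using assms(2) \<open>e/2 > 0\<close> unfolding proj_Cauchy_def by meson
  have "proj_norm (s m + t m - (s n + t n)) < e" if "m \<ge> max N N'" "n \<ge> max N N'" for m n
  proof -
    have "proj_norm (s m + t m - (s n + t n)) \<le> proj_norm (s m - s n) + proj_norm (t m - t n)"
      using proj_norm_triangle[of "s m - s n" "t m - t n"] by (simp add: add_diff_add)
    then show ?thesis using N[of m n] N'[of m n] that by simp
  qed
  then show "\<exists>N. \<forall>m\<ge>N. \<forall>n\<ge>N. proj_norm (s m + t m - (s n + t n)) < e" by blast
qed

lemma proj_Cauchy_scaleC:
  assumes "proj_Cauchy s"
  shows "proj_Cauchy (\<lambda>n. c *\<^sub>C s n)"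
  unfolding proj_Cauchy_def
proof (intro allI impI)
  fix e :: real assume e: "e > 0"
  then have "e / (cmod c + 1) > 0" by (simp add: add_nonneg_pos)
  then obtain N where N: "\<And>m n. m \<ge> N \<Longrightarrow> n \<ge> N \<Longrightarrow> proj_norm (s m - s n) < e / (cmod c + 1)"
    using assms unfolding proj_Cauchy_def by meson
  have "proj_norm (c *\<^sub>C s m - c *\<^sub>C s n) < e" if "m \<ge> N" "n \<ge> N" for m n
  proof -
    have "proj_norm (c *\<^sub>C s m - c *\<^sub>C s n) = cmod c * proj_norm (s m - s n)"
      by (simp add: proj_norm_scaleC flip: complex_vector.scale_right_diff_distrib)
    also have "\<dots> \<le> (cmod c + 1) * proj_norm (s m - s n)"
      by (intro mult_right_mono) (auto simp: proj_norm_nonneg)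
    also have "\<dots> < e"
      using N[OF that] by (simp add: pos_less_divide_eq add_nonneg_pos mult.commute)
    finally show ?thesis .
  qed
  then show "\<exists>N. \<forall>m\<ge>N. \<forall>n\<ge>N. proj_norm (c *\<^sub>C s m - c *\<^sub>C s n) < e" by blast
qed

lemma proj_equiv_add:
  assumes "proj_equiv s t" "proj_equiv s' t'"
  shows "proj_equiv (\<lambda>n. s n + s' n) (\<lambda>n. t n + t' n)"
proof -
  have "(\<lambda>n. proj_norm (s n - t n) + proj_norm (s' n - t' n)) \<longlonglongrightarrow> 0 + 0"
    using assms unfolding proj_equiv_def by (intro tendsto_add) auto
  then have "(\<lambda>n. proj_norm (s n + s' n - (t n + t' n))) \<longlonglongrightarrow> 0"
    unfolding add_diff_add by (intro proj_null_le[OF proj_norm_triangle]) simp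
  then show ?thesis
    using assms by (simp add: proj_equiv_def proj_Cauchy_add)
qed

lemma proj_equiv_scaleC:
  assumes "proj_equiv s t"
  shows "proj_equiv (\<lambda>n. c *\<^sub>C s n) (\<lambda>n. c *\<^sub>C t n)"
proof -
  have "(\<lambda>n. cmod c * proj_norm (s n - t n)) \<longlonglongrightarrow> cmod c * 0"
    using assms unfolding proj_equiv_def by (intro tendsto_mult_left) auto
  then have "(\<lambda>n. proj_norm (c *\<^sub>C s n - c *\<^sub>C t n)) \<longlonglongrightarrow> 0"
    by (simp add: proj_norm_scaleC flip: complex_vector.scale_right_diff_distrib)
  then show ?thesis
    using assms by (simp add: proj_equiv_def proj_Cauchy_scaleC)
qed

lemma proj_Cauchy_norm_convergent:
  assumes "proj_Cauchy s"
  shows "(\<lambda>n. proj_norm (s n)) \<longlonglongrightarrow> lim (\<lambda>n. proj_norm (s n))"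
proof -
  have "Cauchy (\<lambda>n. proj_norm (s n))"
  proof (rule CauchyI)
    fix e :: real assume "e > 0"
    then obtain N where "\<And>m n. m \<ge> N \<Longrightarrow> n \<ge> N \<Longrightarrow> proj_norm (s m - s n) < e"
      using assms unfolding proj_Cauchy_def by meson
    then have "\<forall>m\<ge>N. \<forall>n\<ge>N. norm (proj_norm (s m) - proj_norm (s n)) < e"
      using proj_norm_abs_diff by (metis order_le_less_trans real_norm_def)
    then show "\<exists>N. \<forall>m\<ge>N. \<forall>n\<ge>N. norm (proj_norm (s m) - proj_norm (s n)) < e" ..
  qed
  then show ?thesis by (simp add: Cauchy_convergent_iff convergent_LIMSEQ_iff)
qed

lemma proj_equiv_norm:
  assumes "proj_equiv s t"
  shows "lim (\<lambda>n. proj_norm (s n)) = lim (\<lambda>n. proj_norm (t n))"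
proof -
  have "(\<lambda>n. proj_norm (s n) - proj_norm (t n)) \<longlonglongrightarrow> 0"
    by (rule Lim_null_comparison[of _ "\<lambda>n. proj_norm (s n - t n)"])
      (use assms in \<open>auto simp: proj_equiv_def proj_norm_abs_diff\<close>)
  moreover have "(\<lambda>n. proj_norm (s n) - proj_norm (t n)) \<longlonglongrightarrow>
      lim (\<lambda>n. proj_norm (s n)) - lim (\<lambda>n. proj_norm (t n))"
    using assms by (intro tendsto_diff proj_Cauchy_norm_convergent) (auto simp: proj_equiv_def)
  ultimately show ?thesis using LIMSEQ_unique by fastforce
qed

instantiation ptensor :: (complex_normed_vector, complex_normed_vector) complex_normed_vector
begin

lift_definition zero_ptensor :: "('a, 'b) ptensor" is "\<lambda>_. 0"
  by (simp add: proj_equiv_refl proj_Cauchy_const)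
lift_definition plus_ptensor :: "('a, 'b) ptensor \<Rightarrow> ('a, 'b) ptensor \<Rightarrow> ('a, 'b) ptensor"
  is "\<lambda>s t n. s n + t n" by (rule proj_equiv_add)
lift_definition scaleC_ptensor :: "complex \<Rightarrow> ('a, 'b) ptensor \<Rightarrow> ('a, 'b) ptensor"
  is "\<lambda>c s n. c *\<^sub>C s n" by (rule proj_equiv_scaleC)
lift_definition norm_ptensor :: "('a, 'b) ptensor \<Rightarrow> real"
  is "\<lambda>s. lim (\<lambda>n. proj_norm (s n))" by (rule proj_equiv_norm)
definition uminus_ptensor :: "('a, 'b) ptensor \<Rightarrow> ('a, 'b) ptensor" where
  "uminus_ptensor x = (-1) *\<^sub>C x"
definition minus_ptensor :: "('a, 'b) ptensor \<Rightarrow> ('a, 'b) ptensor \<Rightarrow> ('a, 'b) ptensor" where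
  "minus_ptensor x y = x + (-1) *\<^sub>C y"
definition scaleR_ptensor :: "real \<Rightarrow> ('a, 'b) ptensor \<Rightarrow> ('a, 'b) ptensor" where
  "scaleR_ptensor r x = complex_of_real r *\<^sub>C x"
definition sgn_ptensor :: "('a, 'b) ptensor \<Rightarrow> ('a, 'b) ptensor" where
  "sgn_ptensor x = inverse (norm x) *\<^sub>R x"
definition dist_ptensor :: "('a, 'b) ptensor \<Rightarrow> ('a, 'b) ptensor \<Rightarrow> real" where
  "dist_ptensor x y = norm (x - y)"
definition uniformity_ptensor :: "(('a, 'b) ptensor \<times> ('a, 'b) ptensor) filter" where
  "uniformity_ptensor = (INF e\<in>{0<..}. principal {(x, y). dist x y < e})"
definition open_ptensor :: "('a, 'b) ptensor set \<Rightarrow> bool" where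
  "open_ptensor U \<longleftrightarrow> (\<forall>x\<in>U. eventually (\<lambda>(x', y). x' = x \<longrightarrow> y \<in> U) uniformity)"

instance
proof
  fix x y z :: "('a, 'b) ptensor" and c d :: complex and r s :: real
  show "x + y + z = x + (y + z)"
    by transfer (simp add: add.assoc proj_equiv_refl proj_Cauchy_add)
  show "x + y = y + x"
    by transfer (simp add: add.commute proj_equiv_refl proj_Cauchy_add)
  show "0 + x = x"
    by transfer (simp add: proj_equiv_refl)
  have addr: "c *\<^sub>C (x + y) = c *\<^sub>C x + c *\<^sub>C y" for c and x y :: "('a, 'b) ptensor"
    by transfer (simp add: scaleC_add_right proj_equiv_refl proj_Cauchy_add proj_Cauchy_scaleC)
  have addl: "(c + d) *\<^sub>C x = c *\<^sub>C x + d *\<^sub>C x" for c d and x :: "('a, 'b) ptensor"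
    by transfer (simp add: scaleC_add_left proj_equiv_refl proj_Cauchy_add proj_Cauchy_scaleC)
  have scsc: "c *\<^sub>C d *\<^sub>C x = (c * d) *\<^sub>C x" for c d and x :: "('a, 'b) ptensor"
    by transfer (simp add: scaleC_scaleC proj_equiv_refl proj_Cauchy_scaleC)
  have one: "1 *\<^sub>C x = x" for x :: "('a, 'b) ptensor"
    by transfer (simp add: scaleC_one proj_equiv_refl)
  have zer: "0 *\<^sub>C x = 0" for x :: "('a, 'b) ptensor"
    by transfer (simp add: proj_equiv_refl proj_Cauchy_const)
  show "c *\<^sub>C (x + y) = c *\<^sub>C x + c *\<^sub>C y" by (rule addr)
  show "(c + d) *\<^sub>C x = c *\<^sub>C x + d *\<^sub>C x" by (rule addl)
  show "c *\<^sub>C d *\<^sub>C x = (c * d) *\<^sub>C x" by (rule scsc)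
  show "1 *\<^sub>C x = x" by (rule one)
  have "(-1) *\<^sub>C x + 1 *\<^sub>C x = 0"
    by (simp add: zer flip: addl)
  then show "- x + x = 0" by (simp add: one uminus_ptensor_def)
  show "x - y = x + - y" by (simp add: uminus_ptensor_def minus_ptensor_def)
  show "r *\<^sub>R x = complex_of_real r *\<^sub>C x" by (simp add: scaleR_ptensor_def)
  show "r *\<^sub>R (x + y) = r *\<^sub>R x + r *\<^sub>R y" by (simp add: scaleR_ptensor_def addr)
  show "(r + s) *\<^sub>R x = r *\<^sub>R x + s *\<^sub>R x" by (simp add: scaleR_ptensor_def addl)
  show "r *\<^sub>R s *\<^sub>R x = (r * s) *\<^sub>R x" by (simp add: scaleR_ptensor_def scsc)
  show "1 *\<^sub>R x = x" by (simp add: scaleR_ptensor_def one)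
  show "sgn x = inverse (norm x) *\<^sub>R x" by (rule sgn_ptensor_def)
  show "dist x y = norm (x - y)" by (rule dist_ptensor_def)
  show "uniformity = (INF e\<in>{0<..}. principal {(x :: ('a, 'b) ptensor, y). dist x y < e})"
    by (rule uniformity_ptensor_def)
  show "open U \<longleftrightarrow> (\<forall>x\<in>U. eventually (\<lambda>(x', y). x' = x \<longrightarrow> y \<in> U) uniformity)"
    for U :: "('a, 'b) ptensor set"
    by (rule open_ptensor_def)
  show "norm x = 0 \<longleftrightarrow> x = 0"
  proof transfer
    fix s :: "nat \<Rightarrow> ('a, 'b) atensor"
    assume "proj_equiv s s"
    then have s: "proj_Cauchy s" by (simp add: proj_equiv_refl)
    show "lim (\<lambda>n. proj_norm (s n)) = 0 \<longleftrightarrow> proj_equiv s (\<lambda>_. 0)"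
      using proj_Cauchy_norm_convergent[OF s] s
      by (auto simp: proj_equiv_def proj_Cauchy_const dest: limI)
  qed
  show "norm (x + y) \<le> norm x + norm y"
  proof transfer
    fix s t :: "nat \<Rightarrow> ('a, 'b) atensor"
    assume "proj_equiv s s" "proj_equiv t t"
    then have st: "proj_Cauchy s" "proj_Cauchy t" by (simp_all add: proj_equiv_refl)
    show "lim (\<lambda>n. proj_norm (s n + t n)) \<le> lim (\<lambda>n. proj_norm (s n)) + lim (\<lambda>n. proj_norm (t n))"
      by (rule tendsto_le[OF _ tendsto_add[OF proj_Cauchy_norm_convergent proj_Cauchy_norm_convergent]
            proj_Cauchy_norm_convergent[OF proj_Cauchy_add]])
        (auto simp: st proj_norm_triangle)
  qed
  have nsc: "norm (c *\<^sub>C x) = cmod c * norm x" for c and x :: "('a, 'b) ptensor"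
  proof transfer
    fix c and s :: "nat \<Rightarrow> ('a, 'b) atensor"
    assume "proj_equiv s s"
    then have s: "proj_Cauchy s" by (simp add: proj_equiv_refl)
    have "(\<lambda>n. proj_norm (c *\<^sub>C s n)) \<longlonglongrightarrow> cmod c * lim (\<lambda>n. proj_norm (s n))"
      unfolding proj_norm_scaleC by (intro tendsto_mult_left proj_Cauchy_norm_convergent s)
    then show "lim (\<lambda>n. proj_norm (c *\<^sub>C s n)) = cmod c * lim (\<lambda>n. proj_norm (s n))"
      by (rule limI)
  qed
  show "norm (c *\<^sub>C x) = cmod c * norm x" by (rule nsc)
  show "norm (r *\<^sub>R x) = \<bar>r\<bar> * norm x" by (simp add: scaleR_ptensor_def nsc)
qed

end

definition ptensor_of ::
    "('a::complex_normed_vector, 'b::complex_normed_vector) atensor \<Rightarrow> ('a, 'b) ptensor" where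
  "ptensor_of x = abs_ptensor (\<lambda>_. x)"

lemma ptensor_of_add: "ptensor_of (x + y) = ptensor_of x + ptensor_of y"
  by (simp add: ptensor_of_def plus_ptensor.abs_eq proj_equiv_refl proj_Cauchy_const)

lemma ptensor_of_scaleC: "ptensor_of (c *\<^sub>C x) = c *\<^sub>C ptensor_of x"
  by (simp add: ptensor_of_def scaleC_ptensor.abs_eq proj_equiv_refl proj_Cauchy_const)

lemma ptensor_of_zero: "ptensor_of 0 = 0"
  by (simp add: ptensor_of_def zero_ptensor_def)

lemma ptensor_of_diff: "ptensor_of (x - y) = ptensor_of x - ptensor_of y"
proof -
  have "ptensor_of (x - y) + ptensor_of y = ptensor_of x"
    by (simp flip: ptensor_of_add)
  then show ?thesis by (simp add: eq_diff_eq)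
qed

lemma norm_ptensor_of: "norm (ptensor_of x) = proj_norm x"
  by (simp add: ptensor_of_def norm_ptensor.abs_eq proj_equiv_refl proj_Cauchy_const)

lemma ptensor_dense:
  obtains v where "proj_Cauchy v" "(\<lambda>n. ptensor_of (v n)) \<longlonglongrightarrow> X" "X = abs_ptensor v"
proof -
  have "proj_equiv (rep_ptensor X) (rep_ptensor X)"
    using Quotient3_rep_reflp[OF Quotient3_ptensor] .
  define v where "v = rep_ptensor X"
  have v: "proj_Cauchy v"
    using \<open>proj_equiv (rep_ptensor X) (rep_ptensor X)\<close> by (simp add: v_def proj_equiv_refl)
  have X: "X = abs_ptensor v"
    by (simp add: v_def Quotient3_abs_rep[OF Quotient3_ptensor])
  have "(\<lambda>n. ptensor_of (v n)) \<longlonglongrightarrow> X"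
  proof (rule LIMSEQ_I)
    fix e :: real assume "e > 0"
    then have "e/2 > 0" by simp
    then obtain N where N: "\<And>m n. m \<ge> N \<Longrightarrow> n \<ge> N \<Longrightarrow> proj_norm (v m - v n) < e/2"
      using v unfolding proj_Cauchy_def by meson
    have "norm (ptensor_of (v n) - X) < e" if n: "n \<ge> N" for n
    proof -
      have c: "proj_Cauchy (\<lambda>k. v n - v k)"
        using proj_Cauchy_add[OF proj_Cauchy_const proj_Cauchy_scaleC[OF v, of "-1"], of "v n"] by simp
      have eq: "ptensor_of (v n) - X = abs_ptensor (\<lambda>k. v n - v k)"
      proof -
        have "abs_ptensor (\<lambda>_. v n) + (-1) *\<^sub>C abs_ptensor v = abs_ptensor (\<lambda>k. v n + (-1) *\<^sub>C v k)"
          by (simp only: v proj_equiv_refl proj_Cauchy_const proj_Cauchy_scaleC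
              scaleC_ptensor.abs_eq plus_ptensor.abs_eq)
        then show ?thesis by (simp add: X ptensor_of_def)
      qed
      have "norm (ptensor_of (v n) - X) = lim (\<lambda>k. proj_norm (v n - v k))"
        by (simp add: eq norm_ptensor.abs_eq c proj_equiv_refl)
      also have "\<dots> \<le> e/2"
        by (rule LIMSEQ_le_const2[OF proj_Cauchy_norm_convergent[OF c]])
          (use N[OF n] in \<open>auto intro!: exI[of _ N] less_imp_le\<close>)
      also have "\<dots> < e" using \<open>e > 0\<close> by simp
      finally show ?thesis .
    qed
    then show "\<exists>N. \<forall>n\<ge>N. norm (ptensor_of (v n) - X) < e" by blast
  qed
  then show ?thesis using that v X by blast
qed

lemma ptensor_of_Cauchy_convergent:
  assumes "proj_Cauchy v"
  shows "convergent (\<lambda>n. ptensor_of (v n))"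
proof -
  obtain u where u: "proj_Cauchy u" "(\<lambda>n. ptensor_of (u n)) \<longlonglongrightarrow> abs_ptensor v" "abs_ptensor v = abs_ptensor u"
    by (rule ptensor_dense)
  have "proj_equiv v u"
    using u(1,3) assms Quotient3_rel[OF Quotient3_ptensor, of v u] by (simp add: proj_equiv_refl)
  then have "(\<lambda>n. norm (ptensor_of (v n) - ptensor_of (u n))) \<longlonglongrightarrow> 0"
    by (simp add: proj_equiv_def norm_ptensor_of flip: ptensor_of_diff)
  then have "(\<lambda>n. ptensor_of (v n) - ptensor_of (u n)) \<longlonglongrightarrow> 0"
    by (rule tendsto_norm_zero_cancel)
  from tendsto_add[OF this u(2)] show ?thesis by (auto simp: convergent_def)
qed

instance ptensor :: (complex_normed_vector, complex_normed_vector) complex_banach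
proof
  fix X :: "nat \<Rightarrow> ('a, 'b) ptensor"
  assume X: "Cauchy X"
  have "\<exists>v. norm (X n - ptensor_of v) < inverse (real (Suc n))" for n
  proof -
    obtain v where v: "(\<lambda>k. ptensor_of (v k)) \<longlonglongrightarrow> X n" by (rule ptensor_dense)
    obtain k where "norm (ptensor_of (v k) - X n) < inverse (real (Suc n))"
      using LIMSEQ_D[OF v, of "inverse (real (Suc n))"] by auto
    then show ?thesis by (metis norm_minus_commute)
  qed
  then obtain v where v: "\<And>n. norm (X n - ptensor_of (v n)) < inverse (real (Suc n))"
    by metis
  have "(\<lambda>n. X n - ptensor_of (v n)) \<longlonglongrightarrow> 0"
    by (rule Lim_null_comparison[OF _ LIMSEQ_inverse_real_of_nat])
      (use v in \<open>auto intro!: always_eventually less_imp_le\<close>)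
  then have d: "(\<lambda>n. ptensor_of (v n) - X n) \<longlonglongrightarrow> 0"
    using tendsto_minus by fastforce
  have "Cauchy (\<lambda>n. ptensor_of (v n))"
  proof (rule metric_CauchyI)
    fix e :: real assume "e > 0"
    then have e: "e/3 > 0" by simp
    obtain N where N: "\<And>m n. m \<ge> N \<Longrightarrow> n \<ge> N \<Longrightarrow> dist (X m) (X n) < e/3"
      using metric_CauchyD[OF X e] by blast
    obtain N' where N': "\<And>n. n \<ge> N' \<Longrightarrow> dist (ptensor_of (v n)) (X n) < e/3"
      using LIMSEQ_D[OF d e] by (auto simp: dist_norm)
    have "dist (ptensor_of (v m)) (ptensor_of (v n)) < e" if "m \<ge> max N N'" "n \<ge> max N N'" for m n
      using N[of m n] N'[of m] N'[of n] that
        dist_triangle[of "ptensor_of (v m)" "ptensor_of (v n)" "X m"]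
        dist_triangle[of "X m" "ptensor_of (v n)" "X n"] dist_commute[of "X n" "ptensor_of (v n)"]
      by simp
    then show "\<exists>M. \<forall>m\<ge>M. \<forall>n\<ge>M. dist (ptensor_of (v m)) (ptensor_of (v n)) < e" by blast
  qed
  then have "proj_Cauchy v"
    unfolding proj_Cauchy_def Cauchy_iff
    by (simp add: norm_ptensor_of flip: ptensor_of_diff)
  then obtain L where "(\<lambda>n. ptensor_of (v n)) \<longlonglongrightarrow> L"
    using ptensor_of_Cauchy_convergent by (auto simp: convergent_def)
  from tendsto_diff[OF this d] show "convergent X" by (auto simp: convergent_def)
qed

definition tensor :: "'a::complex_normed_vector \<Rightarrow> 'b::complex_normed_vector \<Rightarrow> ('a, 'b) ptensor" where
  "tensor a b = ptensor_of (atens a b)"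

lemma cbilinear_tensor: "cbilinear tensor"
  unfolding cbilinear_def tensor_def
  by (simp add: cbilinearD[OF cbilinear_atens] ptensor_of_add ptensor_of_scaleC)

lemma norm_tensor_le: "norm (tensor a b) \<le> norm a * norm b"
  by (simp add: tensor_def norm_ptensor_of proj_norm_atens)

theorem ptensor_universal:
  fixes f :: "'a::complex_normed_vector \<Rightarrow> 'b::complex_normed_vector \<Rightarrow> 'c::complex_banach"
  assumes "continuous_cbilinear f"
  shows "\<exists>!F. continuous_clinear_on UNIV F \<and> (\<forall>a b. F (tensor a b) = f a b)"
proof -
  have f: "cbilinear f" using assms by (simp add: continuous_cbilinear_def)
  obtain K where K: "K \<ge> 0" "\<And>a b. norm (f a b) \<le> K * (norm a * norm b)"
    using continuous_cbilinear_bounded[OF assms] by blast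
  note props = atensor_lift_props[OF f]
  have bd: "norm (atensor_lift f x) \<le> K * proj_norm x" for x
    by (rule atensor_lift_bounded[OF f K])
  have diff: "atensor_lift f (x - y) = atensor_lift f x - atensor_lift f y" for x y
    using props(1)[of "x - y" y] by (simp add: eq_diff_eq)
  define rel where "rel X y \<longleftrightarrow>
      (\<exists>v. (\<lambda>n. ptensor_of (v n)) \<longlonglongrightarrow> X \<and> (\<lambda>n. atensor_lift f (v n)) \<longlonglongrightarrow> y)" for X y
  have ex: "\<exists>y. rel X y" for X
  proof -
    obtain v where v: "proj_Cauchy v" "(\<lambda>n. ptensor_of (v n)) \<longlonglongrightarrow> X"
      using ptensor_dense by blast
    have "Cauchy (\<lambda>n. atensor_lift f (v n))"
    proof (rule CauchyI)
      fix e :: real assume e: "e > 0"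
      then have "e / (K + 1) > 0" using K by simp
      then obtain N where N: "\<And>m n. m \<ge> N \<Longrightarrow> n \<ge> N \<Longrightarrow> proj_norm (v m - v n) < e / (K + 1)"
        using v(1) unfolding proj_Cauchy_def by meson
      have "norm (atensor_lift f (v m) - atensor_lift f (v n)) < e" if "m \<ge> N" "n \<ge> N" for m n
      proof -
        have "norm (atensor_lift f (v m) - atensor_lift f (v n)) \<le> K * proj_norm (v m - v n)"
          using bd[of "v m - v n"] by (simp add: diff)
        also have "\<dots> \<le> (K + 1) * proj_norm (v m - v n)"
          by (intro mult_right_mono) (auto simp: proj_norm_nonneg)
        also have "\<dots> < e" using N[OF that] K(1) by (simp add: pos_less_divide_eq mult.commute)
        finally show ?thesis .
      qed
      then show "\<exists>N. \<forall>m\<ge>N. \<forall>n\<ge>N. norm (atensor_lift f (v m) - atensor_lift f (v n)) < e" by blast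
    qed
    then show ?thesis using v(2) unfolding rel_def
      by (meson Cauchy_convergent_iff convergent_def)
  qed
  have rel_bd: "norm y \<le> K * norm X" if r: "rel X y" for X y
  proof -
    obtain v where v: "(\<lambda>n. ptensor_of (v n)) \<longlonglongrightarrow> X" "(\<lambda>n. atensor_lift f (v n)) \<longlonglongrightarrow> y"
      using r unfolding rel_def by blast
    show ?thesis
      by (rule tendsto_le[OF _ tendsto_mult_left[OF tendsto_norm[OF v(1)]] tendsto_norm[OF v(2)]])
        (auto simp: norm_ptensor_of bd)
  qed
  have rel_add: "rel (X + X') (y + y')" if r: "rel X y" "rel X' y'" for X X' y y'
  proof -
    obtain v v' where v: "(\<lambda>n. ptensor_of (v n)) \<longlonglongrightarrow> X" "(\<lambda>n. atensor_lift f (v n)) \<longlonglongrightarrow> y"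
      "(\<lambda>n. ptensor_of (v' n)) \<longlonglongrightarrow> X'" "(\<lambda>n. atensor_lift f (v' n)) \<longlonglongrightarrow> y'"
      using r unfolding rel_def by blast
    show ?thesis unfolding rel_def
      using tendsto_add[OF v(1,3)] tendsto_add[OF v(2,4)]
      by (intro exI[of _ "\<lambda>n. v n + v' n"]) (simp add: ptensor_of_add props)
  qed
  have lim_scaleC: "(\<lambda>n. c *\<^sub>C g n) \<longlonglongrightarrow> c *\<^sub>C l" if g: "g \<longlonglongrightarrow> l"
    for c and g :: "nat \<Rightarrow> 'd::complex_normed_vector" and l
  proof -
    have "(\<lambda>n. cmod c * norm (g n - l)) \<longlonglongrightarrow> cmod c * 0"
      by (intro tendsto_mult_left tendsto_norm_zero LIM_zero g)
    then have "(\<lambda>n. norm (c *\<^sub>C g n - c *\<^sub>C l)) \<longlonglongrightarrow> 0"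
      by (simp add: norm_scaleC flip: complex_vector.scale_right_diff_distrib)
    then show ?thesis by (rule LIM_zero_cancel[OF tendsto_norm_zero_cancel])
  qed
  have rel_scale: "rel (c *\<^sub>C X) (c *\<^sub>C y)" if r: "rel X y" for c X y
  proof -
    obtain v where v: "(\<lambda>n. ptensor_of (v n)) \<longlonglongrightarrow> X" "(\<lambda>n. atensor_lift f (v n)) \<longlonglongrightarrow> y"
      using r unfolding rel_def by blast
    show ?thesis unfolding rel_def
      using lim_scaleC[OF v(1), of c] lim_scaleC[OF v(2), of c]
      by (intro exI[of _ "\<lambda>n. c *\<^sub>C v n"]) (simp add: ptensor_of_scaleC props)
  qed
  have rel_unique: "y = y'" if "rel X y" "rel X y'" for X y y'
    using rel_bd[OF rel_add[OF that(1) rel_scale[OF that(2), of "-1"]]] by simp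
  define F where "F X = (THE y. rel X y)" for X
  have F: "rel X (F X)" for X
    unfolding F_def using ex rel_unique by (metis theI)
  have Fadd: "F (X + Y) = F X + F Y" for X Y
    using rel_unique[OF F rel_add[OF F F]] .
  have Fsc: "F (c *\<^sub>C X) = c *\<^sub>C F X" for c X
    using rel_unique[OF F rel_scale[OF F]] .
  have "bounded_linear F"
  proof (rule bounded_linear_intro[of _ K])
    show "F (X + Y) = F X + F Y" for X Y by (rule Fadd)
    show "F (r *\<^sub>R X) = r *\<^sub>R F X" for r X
      unfolding scaleR_scaleC[of r X] scaleR_scaleC[of r "F X"] by (rule Fsc)
    show "norm (F X) \<le> norm X * K" for X
      using rel_bd[OF F[of X]] by (simp add: mult.commute)
  qed
  then have "continuous_on UNIV F" by (rule linear_continuous_on)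
  then have F_lin: "continuous_clinear_on UNIV F"
    unfolding continuous_clinear_on_def using Fadd Fsc by blast
  have F_tensor: "F (tensor a b) = f a b" for a b
  proof (rule rel_unique[OF F])
    show "rel (tensor a b) (f a b)"
      unfolding rel_def tensor_def
      by (intro exI[of _ "\<lambda>_. atens a b"]) (simp add: props(3))
  qed
  show ?thesis
  proof (rule ex1I[of _ F])
    show "continuous_clinear_on UNIV F \<and> (\<forall>a b. F (tensor a b) = f a b)"
      using F_lin F_tensor by blast
    fix G assume "continuous_clinear_on UNIV G \<and> (\<forall>a b. G (tensor a b) = f a b)"
    then have Gadd: "G (X + Y) = G X + G Y" and Gsc: "G (c *\<^sub>C X) = c *\<^sub>C G X"
      and Gc: "continuous_on UNIV G" and Gt: "G (tensor a b) = f a b" for X Y c a b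
      unfolding continuous_clinear_on_def by blast+
    have G0: "G 0 = 0" using Gadd[of 0 0] by simp
    have "G (ptensor_of (\<Sum>(a, b)\<in>#M. atens a b)) = atensor_lift f (\<Sum>(a, b)\<in>#M. atens a b)" for M
    proof (induction M)
      case empty
      then show ?case using props(1)[of 0 0] by (simp add: ptensor_of_zero G0)
    next
      case (add p M)
      obtain a b where p: "p = (a, b)" by (cases p)
      show ?case
        using add Gt[of a b] by (simp add: p ptensor_of_add Gadd props tensor_def)
    qed
    then have Gof: "G (ptensor_of x) = atensor_lift f x" for x
      by (metis atensor_eq_sum)
    show "G = F"
    proof
      fix X
      obtain v where v: "(\<lambda>n. ptensor_of (v n)) \<longlonglongrightarrow> X" "(\<lambda>n. atensor_lift f (v n)) \<longlonglongrightarrow> F X"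
        using F[of X] unfolding rel_def by blast
      have "isCont G X"
        using Gc continuous_on_eq_continuous_at open_UNIV by blast
      from isCont_tendsto_compose[OF this v(1)] have "(\<lambda>n. atensor_lift f (v n)) \<longlonglongrightarrow> G X"
        by (simp add: Gof)
      then show "G X = F X" using v(2) LIMSEQ_unique by blast
    qed
  qed
qed

definition ptensor_lift ::
    "('a::complex_normed_vector \<Rightarrow> 'b::complex_normed_vector \<Rightarrow> 'c::complex_banach) \<Rightarrow>
     ('a, 'b) ptensor \<Rightarrow> 'c" where
  "ptensor_lift f = (THE F. continuous_clinear_on UNIV F \<and> (\<forall>a b. F (tensor a b) = f a b))"

lemma ptensor_lift:
  assumes "continuous_cbilinear f"
  shows "continuous_clinear_on UNIV (ptensor_lift f)" "ptensor_lift f (tensor a b) = f a b"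
  using theI'[OF ptensor_universal[OF assms]] unfolding ptensor_lift_def by blast+


section \<open>Amenability\<close>

definition left_act :: "'a::complex_banach_algebra \<Rightarrow> ('a, 'a) ptensor \<Rightarrow> ('a, 'a) ptensor" where
  "left_act a = ptensor_lift (\<lambda>b c. tensor (a * b) c)"

definition right_act :: "('a, 'a) ptensor \<Rightarrow> 'a::complex_banach_algebra \<Rightarrow> ('a, 'a) ptensor" where
  "right_act u a = ptensor_lift (\<lambda>b c. tensor b (c * a)) u"

definition mult_map :: "('a, 'a) ptensor \<Rightarrow> 'a::complex_banach_algebra" where
  "mult_map = ptensor_lift (*)"

lemma continuous_cbilinear_left_act:
  fixes a :: "'a::complex_banach_algebra"
  shows "continuous_cbilinear (\<lambda>b (c :: 'a). tensor (a * b) c)"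
proof (rule bounded_imp_continuous_cbilinear)
  show "cbilinear (\<lambda>b (c :: 'a). tensor (a * b) c)"
    unfolding cbilinear_def
    by (simp add: cbilinearD[OF cbilinear_tensor] distrib_left mult_scaleC_right)
  show "norm (tensor (a * b) c) \<le> norm a * (norm b * norm c)" for b c :: 'a
    using norm_tensor_le[of "a * b" c] mult_right_mono[OF norm_mult_ineq[of a b], of "norm c"]
    by (simp add: mult_ac)
qed

lemma continuous_cbilinear_right_act:
  fixes a :: "'a::complex_banach_algebra"
  shows "continuous_cbilinear (\<lambda>(b :: 'a) c. tensor b (c * a))"
proof (rule bounded_imp_continuous_cbilinear)
  show "cbilinear (\<lambda>(b :: 'a) c. tensor b (c * a))"
    unfolding cbilinear_def
    by (simp add: cbilinearD[OF cbilinear_tensor] distrib_right mult_scaleC_left)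
  show "norm (tensor b (c * a)) \<le> norm a * (norm b * norm c)" for b c :: 'a
    using norm_tensor_le[of b "c * a"] mult_left_mono[OF norm_mult_ineq[of c a], of "norm b"]
    by (simp add: mult_ac)
qed

lemma continuous_cbilinear_mult: "continuous_cbilinear ((*) :: 'a \<Rightarrow> 'a \<Rightarrow> 'a::complex_banach_algebra)"
proof (rule bounded_imp_continuous_cbilinear)
  show "cbilinear ((*) :: 'a \<Rightarrow> 'a \<Rightarrow> 'a)"
    unfolding cbilinear_def
    by (simp add: distrib_left distrib_right mult_scaleC_left mult_scaleC_right)
  show "norm (b * c) \<le> 1 * (norm b * norm c)" for b c :: 'a
    by (simp add: norm_mult_ineq)
qed

lemma left_act:
  "continuous_clinear_on UNIV (left_act a)" "left_act a (tensor b c) = tensor (a * b) c"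
  unfolding left_act_def by (rule ptensor_lift[OF continuous_cbilinear_left_act])+

lemma right_act:
  "continuous_clinear_on UNIV (\<lambda>u. right_act u a)" "right_act (tensor b c) a = tensor b (c * a)"
  unfolding right_act_def by (rule ptensor_lift[OF continuous_cbilinear_right_act])+

lemma mult_map:
  "continuous_clinear_on UNIV (mult_map :: ('a, 'a) ptensor \<Rightarrow> 'a::complex_banach_algebra)"
  "mult_map (tensor b c) = b * (c :: 'a)"
  unfolding mult_map_def by (rule ptensor_lift[OF continuous_cbilinear_mult])+

definition directed :: "'i set \<Rightarrow> ('i \<Rightarrow> 'i \<Rightarrow> bool) \<Rightarrow> bool" where
  "directed I le \<longleftrightarrow> I \<noteq> {} \<and> (\<forall>i\<in>I. le i i) \<and>
     (\<forall>i\<in>I. \<forall>j\<in>I. \<forall>k\<in>I. le i j \<longrightarrow> le j k \<longrightarrow> le i k) \<and>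
     (\<forall>i\<in>I. \<forall>j\<in>I. \<exists>k\<in>I. le i k \<and> le j k)"

definition net_tendsto :: "'i set \<Rightarrow> ('i \<Rightarrow> 'i \<Rightarrow> bool) \<Rightarrow> ('i \<Rightarrow> 'a::topological_space) \<Rightarrow> 'a \<Rightarrow> bool" where
  "net_tendsto I le f l \<longleftrightarrow>
     (\<forall>U. open U \<longrightarrow> l \<in> U \<longrightarrow> (\<exists>i\<in>I. \<forall>j\<in>I. le i j \<longrightarrow> f j \<in> U))"

definition approximate_diagonal ::
    "'i set \<Rightarrow> ('i \<Rightarrow> 'i \<Rightarrow> bool) \<Rightarrow> ('i \<Rightarrow> ('a::complex_banach_algebra, 'a) ptensor) \<Rightarrow> bool" where
  "approximate_diagonal I le u \<longleftrightarrow>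
     directed I le \<and>
     (\<exists>C. \<forall>i\<in>I. norm (u i) \<le> C) \<and>
     (\<forall>a. net_tendsto I le (\<lambda>i. left_act a (u i) - right_act (u i) a) 0) \<and>
     (\<forall>a. net_tendsto I le (\<lambda>i. mult_map (u i) * a) a)"

text \<open>Amenability in the form of an approximate diagonal.  A definition cannot quantify over the
  type of the index set; indices of type \<^typ>\<open>'a set \<times> nat\<close> are enough: by \<open>amenableI\<close> below,
  an approximate diagonal with any index type yields one with these.\<close>

definition amenable :: "'a::complex_banach_algebra itself \<Rightarrow> bool" where
  "amenable _ \<longleftrightarrow>
     (\<exists>(I :: ('a set \<times> nat) set) le (u :: _ \<Rightarrow> ('a, 'a) ptensor). approximate_diagonal I le u)"

lemma net_tendsto_iff:
  fixes l :: "'a::metric_space"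
  shows "net_tendsto I le f l \<longleftrightarrow> (\<forall>e>0. \<exists>i\<in>I. \<forall>j\<in>I. le i j \<longrightarrow> dist (f j) l < e)"
proof
  assume L: "net_tendsto I le f l"
  show "\<forall>e>0. \<exists>i\<in>I. \<forall>j\<in>I. le i j \<longrightarrow> dist (f j) l < e"
  proof (intro allI impI)
    fix e :: real assume "e > 0"
    then have "open (ball l e)" "l \<in> ball l e" by auto
    with L have "\<exists>i\<in>I. \<forall>j\<in>I. le i j \<longrightarrow> f j \<in> ball l e"
      unfolding net_tendsto_def by blast
    then show "\<exists>i\<in>I. \<forall>j\<in>I. le i j \<longrightarrow> dist (f j) l < e" by (simp add: dist_commute)
  qed
next
  assume R: "\<forall>e>0. \<exists>i\<in>I. \<forall>j\<in>I. le i j \<longrightarrow> dist (f j) l < e"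
  show "net_tendsto I le f l"
    unfolding net_tendsto_def
  proof (intro allI impI)
    fix U assume "open U" "l \<in> U"
    then obtain e where "e > 0" "\<And>y. dist y l < e \<Longrightarrow> y \<in> U" unfolding open_dist by blast
    moreover from R \<open>e > 0\<close> obtain i where "i \<in> I" "\<forall>j\<in>I. le i j \<longrightarrow> dist (f j) l < e" by blast
    ultimately show "\<exists>i\<in>I. \<forall>j\<in>I. le i j \<longrightarrow> f j \<in> U" by blast
  qed
qed

lemma directedD:
  assumes "directed I le"
  shows "I \<noteq> {}"
    and "i \<in> I \<Longrightarrow> j \<in> I \<Longrightarrow> k \<in> I \<Longrightarrow> le i j \<Longrightarrow> le j k \<Longrightarrow> le i k"
    and "i \<in> I \<Longrightarrow> j \<in> I \<Longrightarrow> \<exists>k\<in>I. le i k \<and> le j k"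
  using assms unfolding directed_def by blast+

lemma directed_finite_upper_bound:
  assumes I: "directed I le" and "finite F" "\<And>x. x \<in> F \<Longrightarrow> g x \<in> I"
  shows "\<exists>i\<in>I. \<forall>x\<in>F. le (g x) i"
  using assms(2,3)
proof (induction F)
  case empty
  then show ?case using directedD(1)[OF I] by blast
next
  case (insert y F)
  then obtain i where i: "i \<in> I" "\<forall>x\<in>F. le (g x) i" by blast
  have "g y \<in> I" using insert.prems by blast
  from directedD(3)[OF I i(1) this] obtain k where k: "k \<in> I" "le i k" "le (g y) k" by blast
  have "le (g x) k" if "x \<in> F" for x
  proof -
    have "g x \<in> I" using insert.prems that by blast
    from directedD(2)[OF I this i(1) k(1) _ k(2)] show ?thesis using i(2) that by blast
  qed
  then show ?case using k by blast
qed

lemma amenableI: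
  fixes I :: "'i set" and u :: "'i \<Rightarrow> ('a::complex_banach_algebra, 'a) ptensor"
  assumes "approximate_diagonal I le u"
  shows "amenable TYPE('a)"
proof -
  have I: "directed I le" using assms by (simp add: approximate_diagonal_def)
  obtain C where C: "\<And>i. i \<in> I \<Longrightarrow> norm (u i) \<le> C"
    using assms unfolding approximate_diagonal_def by blast
  define D where "D a = (\<lambda>i. left_act a (u i) - right_act (u i) a)" for a
  define E where "E a = (\<lambda>i. mult_map (u i) * a)" for a
  have lims: "net_tendsto I le (D a) 0" "net_tendsto I le (E a) a" for a
    using assms unfolding approximate_diagonal_def D_def E_def by blast+
  have ev: "\<exists>i\<in>I. \<forall>j\<in>I. le i j \<longrightarrow> dist (D a j) 0 < e \<and> dist (E a j) a < e" if "e > 0" for a e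
  proof -
    obtain i where i: "i \<in> I" "\<forall>j\<in>I. le i j \<longrightarrow> dist (D a j) 0 < e"
      using lims(1)[of a] \<open>e > 0\<close> unfolding net_tendsto_iff by blast
    obtain i' where i': "i' \<in> I" "\<forall>j\<in>I. le i' j \<longrightarrow> dist (E a j) a < e"
      using lims(2)[of a] \<open>e > 0\<close> unfolding net_tendsto_iff by blast
    obtain k where k: "k \<in> I" "le i k" "le i' k"
      using directedD(3)[OF I i(1) i'(1)] by blast
    have "le i j" "le i' j" if "j \<in> I" "le k j" for j
      using directedD(2)[OF I i(1) k(1) that(1) k(2) that(2)]
        directedD(2)[OF I i'(1) k(1) that(1) k(3) that(2)] by blast+
    then show ?thesis using i i' k(1) by blast
  qed
  define J :: "('a set \<times> nat) set" where "J = {(F, n). finite F}"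
  define le' :: "'a set \<times> nat \<Rightarrow> 'a set \<times> nat \<Rightarrow> bool" where
    "le' p q \<longleftrightarrow> fst p \<subseteq> fst q \<and> snd p \<le> snd q" for p q
  define Q where "Q p i \<longleftrightarrow> i \<in> I \<and> (\<forall>a\<in>fst p.
      dist (D a i) 0 < inverse (real (Suc (snd p))) \<and> dist (E a i) a < inverse (real (Suc (snd p))))"
    for p :: "'a set \<times> nat" and i
  have "\<forall>p\<in>J. \<exists>i. Q p i"
  proof
    fix p assume "p \<in> J"
    define e where "e = inverse (real (Suc (snd p)))"
    have "e > 0" by (simp add: e_def)
    then have "\<forall>a. \<exists>i. i \<in> I \<and> (\<forall>j\<in>I. le i j \<longrightarrow> dist (D a j) 0 < e \<and> dist (E a j) a < e)"
      using ev by blast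
    from choice[OF this] obtain g where g: "\<And>a. g a \<in> I"
      "\<And>a j. j \<in> I \<Longrightarrow> le (g a) j \<Longrightarrow> dist (D a j) 0 < e \<and> dist (E a j) a < e"
      by blast
    have "finite (fst p)" using \<open>p \<in> J\<close> by (auto simp: J_def)
    from directed_finite_upper_bound[where g = g, OF I this g(1)]
    obtain i where "i \<in> I" "\<forall>a\<in>fst p. le (g a) i" by blast
    then have "Q p i" using g(2) unfolding Q_def e_def by blast
    then show "\<exists>i. Q p i" ..
  qed
  from bchoice[OF this] obtain h where "\<forall>p\<in>J. Q p (h p)" ..
  then have h: "\<And>p. p \<in> J \<Longrightarrow> h p \<in> I"
    "\<And>p a. p \<in> J \<Longrightarrow> a \<in> fst p \<Longrightarrow> dist (D a (h p)) 0 < inverse (real (Suc (snd p)))"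
    "\<And>p a. p \<in> J \<Longrightarrow> a \<in> fst p \<Longrightarrow> dist (E a (h p)) a < inverse (real (Suc (snd p)))"
    unfolding Q_def by blast+
  have dir: "directed J le'"
  proof -
    have "({}, 0) \<in> J" by (simp add: J_def)
    moreover have "\<exists>k\<in>J. le' p k \<and> le' q k" if "p \<in> J" "q \<in> J" for p q
      by (rule bexI[of _ "(fst p \<union> fst q, max (snd p) (snd q))"])
        (use that in \<open>auto simp: le'_def J_def\<close>)
    moreover have "\<forall>p\<in>J. le' p p" "\<forall>p\<in>J. \<forall>q\<in>J. \<forall>r\<in>J. le' p q \<longrightarrow> le' q r \<longrightarrow> le' p r"
      unfolding le'_def by (blast intro: order_trans)+
    ultimately show ?thesis unfolding directed_def by (intro conjI ballI) blast+
  qed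
  have lim: "\<exists>p\<in>J. \<forall>q\<in>J. le' p q \<longrightarrow> dist (D a (h q)) 0 < e \<and> dist (E a (h q)) a < e"
    if "e > 0" for a e
  proof -
    obtain n where n: "inverse (real (Suc n)) < e" using reals_Archimedean[OF \<open>e > 0\<close>] by blast
    have "dist (D a (h q)) 0 < e \<and> dist (E a (h q)) a < e" if q: "q \<in> J" "le' ({a}, n) q" for q
    proof -
      have aq: "a \<in> fst q" "n \<le> snd q" using q(2) by (auto simp: le'_def)
      have "inverse (real (Suc (snd q))) \<le> inverse (real (Suc n))"
        using aq(2) by (intro le_imp_inverse_le) auto
      then show ?thesis using h(2,3)[OF q(1) aq(1)] n by linarith
    qed
    moreover have "({a}, n) \<in> J" by (simp add: J_def)
    ultimately show ?thesis by blast
  qed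
  have "approximate_diagonal J le' (\<lambda>p. u (h p))"
    unfolding approximate_diagonal_def net_tendsto_iff
  proof (intro conjI allI impI)
    show "directed J le'" by (rule dir)
    show "\<exists>C. \<forall>p\<in>J. norm (u (h p)) \<le> C" using C h(1) by blast
    fix a and e :: real assume "e > 0"
    show "\<exists>p\<in>J. \<forall>q\<in>J. le' p q \<longrightarrow> dist (left_act a (u (h q)) - right_act (u (h q)) a) 0 < e"
      using lim[OF \<open>e > 0\<close>, of a] unfolding D_def by blast
    show "\<exists>p\<in>J. \<forall>q\<in>J. le' p q \<longrightarrow> dist (mult_map (u (h q)) * a) a < e"
      using lim[OF \<open>e > 0\<close>, of a] unfolding E_def by blast
  qed
  then show ?thesis unfolding amenable_def by blast
qed


section \<open>Property B and commutators\<close>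

definition property_B :: "'a::complex_banach_algebra itself \<Rightarrow> bool" where
  "property_B _ \<longleftrightarrow>
     (\<forall>f :: 'a \<Rightarrow> 'a \<Rightarrow> complex. continuous_cbilinear f \<longrightarrow>
        (\<forall>a b. a * b = 0 \<longrightarrow> f a b = 0) \<longrightarrow>
        (\<forall>a b c. f (a * b) c = f a (b * c)))"

definition commutator :: "'a::ring \<Rightarrow> 'a \<Rightarrow> 'a" where
  "commutator a b = a * b - b * a"

definition jordan_product :: "'a::ring \<Rightarrow> 'a \<Rightarrow> 'a" where
  "jordan_product a b = a * b + b * a"

definition commutator_span :: "'a::complex_banach_algebra set" where
  "commutator_span = complex_vector.span {commutator a b | a b. True}"

end

theory Submission
  imports Defs
begin

text \<open>If \<open>a b = 0\<close> and \<open>c d = 0\<close>, then \<open>b x c\<close> and \<open>d y a\<close> have zero product in both orders.  Applying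
  property B twice to \<open>\<phi>(b x c, d y a)\<close>, and removing the inner factors by means of the bounded
  approximate identity \<open>e\<^sub>\<lambda> = \<pi>(u\<^sub>\<lambda>)\<close>, gives
  \<open>\<phi>(ab, cd) - \<phi>(dab, c) = \<phi>(a, bcd) - \<phi>(da, bc)\<close>.  Putting \<open>c = e\<^sub>\<lambda>\<close> shows that
  \<open>\<tau>(x) = lim \<phi>(x, e\<^sub>\<lambda>)\<close> exists and that \<open>\<phi>(ab, c) + \<phi>(ca, b) = \<tau>(cab) + \<phi>(a, bc)\<close>.  With
  \<open>a = e\<^sub>\<lambda>\<close> this expresses the symmetric part of \<open>\<phi>\<close> through \<open>\<tau>(a \<circ> b)\<close>.  If \<open>\<phi>\<close> is
  antisymmetric, \<open>\<tau>\<close> is a trace and \<open>\<phi>(a, b) + \<tau>(ab)\<close> is a derivation in \<open>a\<close>; by amenability it is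
  inner, that is, it depends only on \<open>[a, b]\<close>, which in turn forces \<open>\<tau> = 0\<close>.\<close>

section \<open>Separating functionals\<close>

text \<open>Homogeneity is required only as an inequality for positive \<open>s\<close>, which is
  all that infima deliver directly; applying it to \<open>s\<close> and to its inverse recovers the
  equality.\<close>

definition sublinear :: "('a::real_vector \<Rightarrow> real) \<Rightarrow> bool" where
  "sublinear p \<longleftrightarrow> (\<forall>x y. p (x + y) \<le> p x + p y) \<and> (\<forall>s>0. \<forall>x. p (s *\<^sub>R x) \<le> s * p x)"

lemma sublinearD:
  assumes "sublinear p"
  shows "p (x + y) \<le> p x + p y" "s > 0 \<Longrightarrow> p (s *\<^sub>R x) \<le> s * p x"
  using assms unfolding sublinear_def by blast+

lemma sublinear_zero: "sublinear p \<Longrightarrow> p 0 = 0"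
  using sublinearD(2)[of p 2 0] sublinearD(2)[of p "1/2" 0] by simp

lemma sublinear_neg_le: "sublinear p \<Longrightarrow> - p (- x) \<le> p x"
  using sublinearD(1)[of p x "- x"] sublinear_zero[of p] by simp

lemma sublinear_scaleR:
  assumes p: "sublinear p" and "s \<ge> 0"
  shows "p (s *\<^sub>R x) = s * p x"
proof (cases "s = 0")
  case False
  then have s: "s > 0" using assms(2) by simp
  have "p (inverse s *\<^sub>R s *\<^sub>R x) \<le> inverse s * p (s *\<^sub>R x)"
    using s by (intro sublinearD(2)[OF p]) simp
  then have "s * p x \<le> p (s *\<^sub>R x)" using s by (simp add: field_simps)
  then show ?thesis using sublinearD(2)[OF p s, of x] by simp
qed (simp add: sublinear_zero[OF p])

text \<open>Lowering \<^term>\<open>p\<close> in the direction \<^term>\<open>- y\<close> as far as possible; a minimal sublinear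
  functional cannot be lowered, hence is odd and so linear.\<close>

definition lowered :: "('a::real_vector \<Rightarrow> real) \<Rightarrow> 'a \<Rightarrow> 'a \<Rightarrow> real" where
  "lowered p y x = (INF t\<in>{0..}. p (x + t *\<^sub>R y) - t * p y)"

lemma lowered_le:
  assumes p: "sublinear p" and "t \<ge> 0"
  shows "lowered p y x \<le> p (x + t *\<^sub>R y) - t * p y"
  unfolding lowered_def
proof (rule cINF_lower)
  show "bdd_below ((\<lambda>t. p (x + t *\<^sub>R y) - t * p y) ` {0..})"
  proof (rule bdd_belowI2)
    fix t :: real assume "t \<in> {0..}"
    then have "t * p y = p (t *\<^sub>R y)" by (simp add: sublinear_scaleR[OF p])
    \<comment> \<open>\<open>t *\<^sub>R y\<close> is the sum of \<open>x + t *\<^sub>R y\<close>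
      and \<open>- x\<close>, so subadditivity gives a lower bound that does not depend on
      \<open>t\<close>.\<close>
    then show "- p (- x) \<le> p (x + t *\<^sub>R y) - t * p y"
      using sublinearD(1)[OF p, of "x + t *\<^sub>R y" "- x"] by simp
  qed
qed (use assms in simp)

lemma lowered_ge:
  assumes "\<And>t. t \<ge> 0 \<Longrightarrow> B \<le> p (x + t *\<^sub>R y) - t * p y"
  shows "B \<le> lowered p y x"
  unfolding lowered_def by (rule cINF_greatest) (use assms in auto)

lemma lowered_le_self: "sublinear p \<Longrightarrow> lowered p y x \<le> p x"
  using lowered_le[of p 0 y x] by simp

lemma lowered_neg_le: "sublinear p \<Longrightarrow> lowered p y (- y) \<le> - p y"
  using lowered_le[of p 1 y "- y"] by (simp add: sublinear_zero)

text \<open>Parameters combine: \<open>t\<close> for \<open>x\<close> and \<open>t'\<close> for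
  \<open>x'\<close> give the competitor \<open>t + t'\<close> for \<open>x + x'\<close>, and
  \<open>t\<close> for \<open>x\<close> gives \<open>s * t\<close> for
  \<open>s *\<^sub>R x\<close>.\<close>

lemma sublinear_lowered:
  assumes p: "sublinear p"
  shows "sublinear (lowered p y)"
  unfolding sublinear_def
proof (intro conjI allI impI)
  fix x x'
  have "lowered p y (x + x') - (p (x + t *\<^sub>R y) - t * p y) \<le> lowered p y x'" if t: "t \<ge> 0" for t
  proof (rule lowered_ge)
    fix t' :: real assume "t' \<ge> 0"
    then have "lowered p y (x + x') \<le> p ((x + t *\<^sub>R y) + (x' + t' *\<^sub>R y)) - (t + t') * p y"
      using lowered_le[OF p, of "t + t'" y "x + x'"] t by (simp add: algebra_simps)
    also have "p ((x + t *\<^sub>R y) + (x' + t' *\<^sub>R y)) \<le> p (x + t *\<^sub>R y) + p (x' + t' *\<^sub>R y)"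
      by (rule sublinearD(1)[OF p])
    finally show "lowered p y (x + x') - (p (x + t *\<^sub>R y) - t * p y) \<le> p (x' + t' *\<^sub>R y) - t' * p y"
      by (simp add: algebra_simps)
  qed
  then have "lowered p y (x + x') - lowered p y x' \<le> lowered p y x"
    by (intro lowered_ge) (simp add: algebra_simps)
  then show "lowered p y (x + x') \<le> lowered p y x + lowered p y x'" by simp
next
  fix s :: real and x assume s: "s > 0"
  have "inverse s * lowered p y (s *\<^sub>R x) \<le> lowered p y x"
  proof (rule lowered_ge)
    fix t :: real assume t: "t \<ge> 0"
    have "lowered p y (s *\<^sub>R x) \<le> p (s *\<^sub>R (x + t *\<^sub>R y)) - s * t * p y"
      using lowered_le[OF p, of "s * t" y "s *\<^sub>R x"] s t by (simp add: scaleR_add_right)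
    also have "\<dots> = s * (p (x + t *\<^sub>R y) - t * p y)"
      using s by (simp only: sublinear_scaleR[OF p] less_imp_le right_diff_distrib mult.assoc)
    finally show "inverse s * lowered p y (s *\<^sub>R x) \<le> p (x + t *\<^sub>R y) - t * p y"
      using s by (simp add: field_simps)
  qed
  then show "lowered p y (s *\<^sub>R x) \<le> s * lowered p y x"
    using s by (simp add: field_simps)
qed

text \<open>The common upper bound \<open>q\<close> bounds the values at \<open>x\<close> from below
  by \<open>- q (- x)\<close>. For subadditivity, two members of the chain, one for each summand,
  may be replaced by the smaller of them.\<close>

lemma sublinear_chain_Inf:
  fixes C :: "('a::real_vector \<Rightarrow> real) set"
  assumes C: "C \<noteq> {}" "\<And>p. p \<in> C \<Longrightarrow> sublinear p"
    and q: "\<And>p x. p \<in> C \<Longrightarrow> p x \<le> q x"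
    and chain: "\<And>p p'. p \<in> C \<Longrightarrow> p' \<in> C \<Longrightarrow> p \<le> p' \<or> p' \<le> p"
  shows "sublinear (\<lambda>x. INF p\<in>C. p x)" and "p \<in> C \<Longrightarrow> (INF p\<in>C. p x) \<le> p x"
proof -
  have bdd: "bdd_below ((\<lambda>p. p x) ` C)" for x
  proof (rule bdd_belowI2)
    show "- q (- x) \<le> p x" if "p \<in> C" for p
      using q[OF that, of "- x"] sublinear_neg_le[OF C(2)[OF that], of x] by simp
  qed
  have le: "(INF p\<in>C. p x) \<le> p x" if "p \<in> C" for p x
    by (rule cINF_lower[OF bdd that])
  then show "p \<in> C \<Longrightarrow> (INF p\<in>C. p x) \<le> p x" .
  show "sublinear (\<lambda>x. INF p\<in>C. p x)"
    unfolding sublinear_def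
  proof (intro conjI allI impI)
    fix x y
    have *: "(INF p\<in>C. p (x + y)) \<le> p x + p' y" if p: "p \<in> C" "p' \<in> C" for p p'
    proof -
      obtain p'' where p'': "p'' \<in> C" "p'' \<le> p" "p'' \<le> p'"
        using chain[OF p] p by blast
      have "(INF p\<in>C. p (x + y)) \<le> p'' x + p'' y"
        using le[OF p''(1), of "x + y"] sublinearD(1)[OF C(2)[OF p''(1)], of x y] by simp
      then show ?thesis using p''(2,3) by (meson le_funD add_mono order_trans)
    qed
    have "(INF p\<in>C. p (x + y)) - p x \<le> (INF p\<in>C. p y)" if p: "p \<in> C" for p
    proof (rule cINF_greatest[OF C(1)])
      show "(INF p\<in>C. p (x + y)) - p x \<le> p' y" if "p' \<in> C" for p'
        using *[OF p that] by simp
    qed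
    then have "(INF p\<in>C. p (x + y)) - (INF p\<in>C. p y) \<le> (INF p\<in>C. p x)"
      by (intro cINF_greatest[OF C(1)]) (simp add: algebra_simps)
    then show "(INF p\<in>C. p (x + y)) \<le> (INF p\<in>C. p x) + (INF p\<in>C. p y)" by simp
  next
    fix s :: real and x assume s: "s > 0"
    have "(INF p\<in>C. p (s *\<^sub>R x)) / s \<le> (INF p\<in>C. p x)"
    proof (rule cINF_greatest[OF C(1)])
      fix p assume p: "p \<in> C"
      show "(INF p\<in>C. p (s *\<^sub>R x)) / s \<le> p x"
        using le[OF p, of "s *\<^sub>R x"] sublinearD(2)[OF C(2)[OF p] s, of x] s
        by (simp add: field_simps)
    qed
    then show "(INF p\<in>C. p (s *\<^sub>R x)) \<le> s * (INF p\<in>C. p x)"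
      using s by (simp add: field_simps)
  qed
qed

text \<open>Zorn's lemma for the reversed pointwise order: a nonempty chain is bounded by its
  pointwise infimum, the empty one by \<open>q\<close>.\<close>

lemma sublinear_minimal:
  assumes q: "sublinear q"
  obtains p where "sublinear p" "p \<le> q" "\<And>p'. sublinear p' \<Longrightarrow> p' \<le> p \<Longrightarrow> p' = p"
proof -
  define A where "A = {p. sublinear p \<and> p \<le> q}"
  have "\<exists>m\<in>A. \<forall>a\<in>A. m \<ge> a \<longrightarrow> a = m"
  proof (rule predicate_Zorn)
    show "partial_order_on A (relation_of (\<ge>) A)"
      by (rule partial_order_on_relation_ofI) auto
    fix C assume C: "C \<in> Chains (relation_of (\<ge>) A)"
    show "\<exists>u\<in>A. \<forall>a\<in>C. a \<ge> u"
    proof (cases "C = {}")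
      case True
      then show ?thesis using q by (auto simp: A_def)
    next
      case False
      have CA: "p \<in> C \<Longrightarrow> sublinear p \<and> p \<le> q" for p
        using C unfolding Chains_def relation_of_def A_def by blast
      have chain: "p \<le> p' \<or> p' \<le> p" if "p \<in> C" "p' \<in> C" for p p'
        using C that unfolding Chains_def relation_of_def by blast
      define u where "u = (\<lambda>x. INF p\<in>C. p x)"
      have "sublinear u" and le: "\<And>p x. p \<in> C \<Longrightarrow> u x \<le> p x"
        unfolding u_def using CA chain
        by (intro sublinear_chain_Inf[OF False, where q = q]; auto simp: le_fun_def)+
      moreover from this(2) False CA have "u \<le> q" unfolding le_fun_def
        by (meson all_not_in_conv order_trans)
      ultimately show ?thesis by (auto simp: A_def le_fun_def)
    qed
  qed
  then obtain p where "p \<in> A" "\<And>a. a \<in> A \<Longrightarrow> a \<le> p \<Longrightarrow> a = p" by blast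
  then show ?thesis using that[of p] by (auto simp: A_def)
qed

lemma sublinear_minimal_linear:
  assumes p: "sublinear p" and min: "\<And>p'. sublinear p' \<Longrightarrow> p' \<le> p \<Longrightarrow> p' = p"
  shows "linear p"
proof -
  have neg: "p (- y) = - p y" for y
  proof -
    have "lowered p y = p"
      by (intro min sublinear_lowered[OF p]) (auto simp: le_fun_def lowered_le_self[OF p])
    then have "p (- y) \<le> - p y" using lowered_neg_le[OF p, of y] by simp
    then show ?thesis using sublinear_neg_le[OF p, of y] by simp
  qed
  show ?thesis
  proof
    show "p (x + y) = p x + p y" for x y
      using sublinearD(1)[OF p, of x y] sublinearD(1)[OF p, of "- x" "- y"] neg[of "x + y"]
      by (simp add: neg)
    show "p (r *\<^sub>R x) = r *\<^sub>R p x" for r x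
      using sublinear_scaleR[OF p, of r x] sublinear_scaleR[OF p, of "- r" x] neg[of "r *\<^sub>R x"]
      by (cases "r \<ge> 0") auto
  qed
qed

text \<open>No extension from a subspace is made: minimizing below \<open>lowered norm v\<close>
  instead of below the norm forces \<open>g (- v) \<le> - norm v\<close>, and linearity turns this
  into \<open>g v \<ge> norm v\<close>.\<close>

lemma Hahn_Banach_separating_real:
  fixes v :: "'a::real_normed_vector"
  obtains g :: "'a \<Rightarrow> real" where "linear g" "\<And>x. \<bar>g x\<bar> \<le> norm x" "g v = norm v"
proof -
  have n: "sublinear (norm :: 'a \<Rightarrow> real)"
    by (auto simp: sublinear_def norm_triangle_ineq)
  obtain g where g: "sublinear g" "g \<le> lowered norm v"
    "\<And>p'. sublinear p' \<Longrightarrow> p' \<le> g \<Longrightarrow> p' = g"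
    using sublinear_minimal[OF sublinear_lowered[OF n]] by blast
  have lin: "linear g" by (rule sublinear_minimal_linear[OF g(1,3)])
  have le: "g x \<le> norm x" for x
    using g(2) lowered_le_self[OF n, of v x] by (meson le_funD order_trans)
  have "g (- v) \<le> - norm v"
    using g(2) lowered_neg_le[OF n, of v] by (meson le_funD order_trans)
  then have "g v = norm v" using le[of v] by (simp add: linear_neg[OF lin])
  moreover have "\<bar>g x\<bar> \<le> norm x" for x
    using le[of x] le[of "- x"] by (simp add: linear_neg[OF lin])
  ultimately show ?thesis using that lin by blast
qed

section \<open>Continuous linear and bilinear maps\<close>

lemma continuous_clinear_imp_bounded_linear:
  assumes "continuous_clinear_on UNIV f"
  shows "bounded_linear f"
proof -
  obtain K where "\<And>x. norm (f x) \<le> K * norm x"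
    using continuous_clinear_bounded[OF assms] by blast
  moreover have "f (x + y) = f x + f y" "f (c *\<^sub>C x) = c *\<^sub>C f x" for c x y
    using assms unfolding continuous_clinear_on_def by blast+
  ultimately show ?thesis
    by (intro bounded_linear_intro[of _ K]) (simp_all add: scaleR_scaleC mult.commute)
qed

lemma continuous_clinear_scaleC:
  "continuous_clinear_on UNIV f \<Longrightarrow> f (c *\<^sub>C x) = c *\<^sub>C f x"
  unfolding continuous_clinear_on_def by blast

lemma bounded_linear_imp_continuous_clinear:
  assumes "bounded_linear f" "\<And>c x. f (c *\<^sub>C x) = c *\<^sub>C f x"
  shows "continuous_clinear_on UNIV f"
  using assms linear_continuous_on[OF assms(1)]
  by (simp add: continuous_clinear_on_def linear_simps)

lemma bounded_linear_scaleC: "bounded_linear (\<lambda>x::'a::complex_normed_vector. c *\<^sub>C x)"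
  by (rule bounded_linear_intro[of _ "cmod c"])
    (simp_all add: scaleC_add_right norm_scaleC scaleR_scaleC scaleC_scaleC mult.commute)

lemmas tendsto_scaleC = bounded_linear.tendsto[OF bounded_linear_scaleC]

lemma continuous_cbilinear_imp_bounded_bilinear:
  assumes "continuous_cbilinear f"
  shows "bounded_bilinear f"
proof -
  have f: "cbilinear f" using assms by (simp add: continuous_cbilinear_def)
  obtain K where K: "\<And>a b. norm (f a b) \<le> K * (norm a * norm b)"
    using continuous_cbilinear_bounded[OF assms] by blast
  show ?thesis
    by standard (use K in \<open>auto simp: cbilinearD[OF f] cbilinear_scaleR[OF f] mult.commute\<close>)
qed

lemma continuous_cbilinear_scaleC:
  assumes "continuous_cbilinear f"
  shows "f (c *\<^sub>C a) b = c *\<^sub>C f a b" "f a (c *\<^sub>C b) = c *\<^sub>C f a b"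
  using assms unfolding continuous_cbilinear_def cbilinear_def by blast+

lemma bounded_bilinear_imp_continuous_cbilinear:
  assumes f: "bounded_bilinear f"
    and "\<And>c a b. f (c *\<^sub>C a) b = c *\<^sub>C f a b" "\<And>c a b. f a (c *\<^sub>C b) = c *\<^sub>C f a b"
  shows "continuous_cbilinear f"
proof -
  have "cbilinear f"
    using assms by (simp add: cbilinear_def bounded_bilinear.add_left bounded_bilinear.add_right)
  moreover have "continuous_on UNIV (\<lambda>p. f (fst p) (snd p))"
    by (rule bounded_bilinear.continuous_on[OF f]) (intro continuous_intros)+
  ultimately show ?thesis by (simp add: continuous_cbilinear_def case_prod_beta)
qed

lemma continuous_cbilinear_compose:
  assumes "continuous_cbilinear f" "continuous_clinear_on UNIV L" "continuous_clinear_on UNIV M"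
  shows "continuous_cbilinear (\<lambda>a b. f (L a) (M b))"
  by (rule bounded_bilinear_imp_continuous_cbilinear[OF bounded_bilinear.comp[OF
          continuous_cbilinear_imp_bounded_bilinear[OF assms(1)]
          continuous_clinear_imp_bounded_linear[OF assms(2)]
          continuous_clinear_imp_bounded_linear[OF assms(3)]]])
    (use assms in \<open>simp_all add: continuous_clinear_scaleC continuous_cbilinear_scaleC\<close>)

lemma continuous_clinear_compose_cbilinear:
  assumes L: "continuous_clinear_on UNIV L" and f: "continuous_cbilinear f"
  shows "continuous_cbilinear (\<lambda>a b. L (f a b))"
proof -
  interpret L: bounded_linear L by (rule continuous_clinear_imp_bounded_linear[OF L])
  have "cbilinear (\<lambda>a b. L (f a b))"
    using f unfolding continuous_cbilinear_def cbilinear_def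
    by (simp add: L.add continuous_clinear_scaleC[OF L])
  moreover have "continuous_on UNIV (\<lambda>p. L (f (fst p) (snd p)))"
    using f unfolding continuous_cbilinear_def case_prod_beta by (intro L.continuous_on) blast
  ultimately show ?thesis by (simp add: continuous_cbilinear_def case_prod_beta)
qed

lemma continuous_cbilinear_swap:
  assumes "continuous_cbilinear f"
  shows "continuous_cbilinear (\<lambda>a b. f b a)"
  by (rule bounded_bilinear_imp_continuous_cbilinear[OF bounded_bilinear.flip[OF
          continuous_cbilinear_imp_bounded_bilinear[OF assms]]])
    (simp_all add: continuous_cbilinear_scaleC[OF assms])

lemma continuous_cbilinear_add:
  assumes "continuous_cbilinear f" "continuous_cbilinear g"
  shows "continuous_cbilinear (\<lambda>a b. f a b + g a b)"
  unfolding continuous_cbilinear_def case_prod_beta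
proof
  show "cbilinear (\<lambda>a b. f a b + g a b)"
    using assms unfolding continuous_cbilinear_def cbilinear_def
    by (simp add: scaleC_add_right)
  show "continuous_on UNIV (\<lambda>p. f (fst p) (snd p) + g (fst p) (snd p))"
    using assms unfolding continuous_cbilinear_def case_prod_beta by (intro continuous_on_add) blast+
qed

lemma continuous_cbilinear_diff:
  assumes "continuous_cbilinear f" "continuous_cbilinear g"
  shows "continuous_cbilinear (\<lambda>a b. f a b - g a b)"
  unfolding continuous_cbilinear_def case_prod_beta
proof
  show "cbilinear (\<lambda>a b. f a b - g a b)"
    using assms unfolding continuous_cbilinear_def cbilinear_def
    by (simp add: complex_vector.scale_right_diff_distrib)
  show "continuous_on UNIV (\<lambda>p. f (fst p) (snd p) - g (fst p) (snd p))"
    using assms unfolding continuous_cbilinear_def case_prod_beta by (intro continuous_on_diff) blast+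
qed

lemma continuous_clinear_mult:
  fixes p :: "'a::complex_banach_algebra"
  shows "continuous_clinear_on UNIV (\<lambda>a. p * a)" "continuous_clinear_on UNIV (\<lambda>a. a * p)"
    "continuous_clinear_on UNIV (\<lambda>a. p * a * q)"
proof -
  show "continuous_clinear_on UNIV (\<lambda>a. p * a)"
    by (intro bounded_linear_imp_continuous_clinear bounded_linear_mult_right mult_scaleC_right)
  show "continuous_clinear_on UNIV (\<lambda>a. a * p)"
    by (intro bounded_linear_imp_continuous_clinear bounded_linear_mult_left mult_scaleC_left)
  show "continuous_clinear_on UNIV (\<lambda>a. p * a * q)"
    by (rule bounded_linear_imp_continuous_clinear[OF bounded_linear_compose[OF
            bounded_linear_mult_left bounded_linear_mult_right]])
      (simp add: mult_scaleC_left mult_scaleC_right)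
qed

section \<open>Limits of uniformly bounded operators\<close>

text \<open>The uniform bound makes the operators equicontinuous, so the values at \<open>x\<close>
  stay close to those at a nearby point of \<open>S\<close>, where they converge; hence they form a
  Cauchy filter.\<close>

lemma operator_limit_closure:
  fixes T :: "'i \<Rightarrow> 'a::real_normed_vector \<Rightarrow> 'b::banach"
  assumes F: "F \<noteq> bot" and diff: "\<And>i x y. T i (x - y) = T i x - T i y"
    and bound: "\<forall>\<^sub>F i in F. \<forall>x. norm (T i x) \<le> K * norm x"
    and conv: "\<And>x. x \<in> S \<Longrightarrow> \<exists>l. ((\<lambda>i. T i x) \<longlongrightarrow> l) F"
    and x: "x \<in> closure S"
  shows "\<exists>l. ((\<lambda>i. T i x) \<longlongrightarrow> l) F"
proof -
  have "cauchy_filter (filtermap (\<lambda>i. T i x) F)"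
    unfolding cauchy_filter_metric_filtermap
  proof (intro allI impI)
    fix e :: real assume e: "e > 0"
    \<comment> \<open>Both \<open>T i x\<close> to \<open>T i y\<close> and \<open>T i y\<close> to
      \<open>l\<close> cost at most \<open>e/4\<close>; \<open>\<bar>K\<bar> + 1\<close> keeps the
      denominator positive whatever the sign of \<open>K\<close>.\<close>
    define d where "d = e / (4 * (\<bar>K\<bar> + 1))"
    have "d > 0" using e by (simp add: d_def)
    then obtain y where y: "y \<in> S" "dist y x < d"
      using x unfolding closure_approachable by blast
    obtain l where l: "((\<lambda>i. T i y) \<longlongrightarrow> l) F" using conv[OF y(1)] by blast
    define P where "P i \<longleftrightarrow> (\<forall>x. norm (T i x) \<le> K * norm x) \<and> dist (T i y) l < e/4" for i
    have "eventually P F"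
      unfolding P_def using bound tendstoD[OF l, of "e/4"] e by (simp add: eventually_conj)
    moreover have "dist (T i x) (T j x) < e" if ij: "P i" "P j" for i j
    proof -
      have near: "dist (T k x) l < e/2" if "P k" for k
      proof -
        have "dist (T k x) (T k y) \<le> K * dist y x"
          using that unfolding P_def dist_norm diff[symmetric] by (metis norm_minus_commute)
        also have "\<dots> \<le> (\<bar>K\<bar> + 1) * dist y x" by (intro mult_right_mono) auto
        also have "\<dots> < (\<bar>K\<bar> + 1) * d" using y(2) by (intro mult_strict_left_mono) auto
        also have "\<dots> = e/4"
          by (simp add: d_def field_simps add_nonneg_eq_0_iff)
        finally show ?thesis
          using that dist_triangle[of "T k x" l "T k y"] unfolding P_def by linarith
      qed
      show ?thesis using near[OF ij(1)] near[OF ij(2)] dist_triangle2[of "T i x" "T j x" l] by linarith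
    qed
    ultimately show "\<exists>P. eventually P F \<and> (\<forall>i j. P i \<and> P j \<longrightarrow> dist (T i x) (T j x) < e)" by blast
  qed
  from cauchy_filter_complete_converges[OF this complete_UNIV] F
  show ?thesis by (auto simp: filterlim_def filtermap_bot_iff)
qed

text \<open>The bound passes to the limit and, as \<open>V\<close> contains differences, makes
  \<open>L\<close> Lipschitz there. The cases of interest are the whole space and
  \<open>commutator_span\<close>.\<close>

lemma continuous_clinear_operator_limit:
  fixes T :: "'i \<Rightarrow> 'a::complex_normed_vector \<Rightarrow> 'b::complex_normed_vector"
  assumes F: "F \<noteq> bot" and T: "\<And>i. continuous_clinear_on UNIV (T i)"
    and bound: "\<forall>\<^sub>F i in F. \<forall>x. norm (T i x) \<le> K * norm x"
    and V: "complex_vector.subspace V"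
    and lim: "\<And>x. x \<in> V \<Longrightarrow> ((\<lambda>i. T i x) \<longlongrightarrow> L x) F"
  shows "continuous_clinear_on V L"
proof -
  have add: "T i (x + y) = T i x + T i y" and scale: "T i (c *\<^sub>C x) = c *\<^sub>C T i x" for i c x y
    using T[of i] unfolding continuous_clinear_on_def by blast+
  have L_add: "L (x + y) = L x + L y" if "x \<in> V" "y \<in> V" for x y
    using tendsto_unique[OF F lim[OF complex_vector.subspace_add[OF V that]]]
      tendsto_add[OF lim lim, OF that] by (simp add: add)
  have L_scale: "L (c *\<^sub>C x) = c *\<^sub>C L x" if "x \<in> V" for c x
    using tendsto_unique[OF F lim[OF complex_vector.subspace_scale[OF V that]]]
      tendsto_scaleC[OF lim[OF that]] by (simp add: scale)
  have L_bound: "norm (L x) \<le> K * norm x" if "x \<in> V" for x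
  proof (rule tendsto_upperbound[OF tendsto_norm[OF lim[OF that]] _ F])
    show "\<forall>\<^sub>F i in F. norm (T i x) \<le> K * norm x" by (rule eventually_mono[OF bound]) blast
  qed
  have "\<bar>K\<bar>-lipschitz_on V L"
  proof (rule lipschitz_onI)
    fix x y assume xy: "x \<in> V" "y \<in> V"
    then have d: "x - y \<in> V" by (rule complex_vector.subspace_diff[OF V])
    have "L (x - y) + L y = L x" using L_add[OF d xy(2)] by simp
    then have "L x - L y = L (x - y)" by (simp add: diff_eq_eq)
    then have "dist (L x) (L y) = norm (L (x - y))" by (simp add: dist_norm)
    also have "\<dots> \<le> K * norm (x - y)" by (rule L_bound[OF d])
    also have "\<dots> \<le> \<bar>K\<bar> * norm (x - y)" by (intro mult_right_mono) auto
    finally show "dist (L x) (L y) \<le> \<bar>K\<bar> * dist x y" by (simp add: dist_norm)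
  qed simp
  then have "continuous_on V L" by (rule lipschitz_on_continuous_on)
  then show ?thesis unfolding continuous_clinear_on_def using L_add L_scale by blast
qed

lemma continuous_clinear_compose:
  assumes "continuous_clinear_on UNIV f" "continuous_clinear_on UNIV g"
  shows "continuous_clinear_on UNIV (\<lambda>x. f (g x))"
  by (rule bounded_linear_imp_continuous_clinear[OF bounded_linear_compose])
    (use assms in \<open>simp_all add: continuous_clinear_imp_bounded_linear continuous_clinear_scaleC\<close>)

lemma continuous_clinear_add:
  assumes "continuous_clinear_on UNIV f" "continuous_clinear_on UNIV g"
  shows "continuous_clinear_on UNIV (\<lambda>x. f x + g x)"
  by (rule bounded_linear_imp_continuous_clinear[OF bounded_linear_add])
    (use assms in \<open>simp_all add: continuous_clinear_imp_bounded_linear continuous_clinear_scaleC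
      scaleC_add_right\<close>)

lemma continuous_clinear_on_scaleC:
  assumes "continuous_clinear_on V f"
  shows "continuous_clinear_on V (\<lambda>x. c *\<^sub>C f x)"
  using assms unfolding continuous_clinear_on_def
  by (auto simp: scaleC_add_right scaleC_scaleC mult.commute
      intro!: bounded_linear.continuous_on[OF bounded_linear_scaleC])

lemma Hahn_Banach_separating_complex:
  fixes v :: "'a::complex_normed_vector"
  assumes "v \<noteq> 0"
  obtains f :: "'a \<Rightarrow> complex" where "continuous_clinear_on UNIV f" "f v \<noteq> 0"
proof -
  obtain g :: "'a \<Rightarrow> real" where g: "linear g" "\<And>x. \<bar>g x\<bar> \<le> norm x" "g v = norm v"
    using Hahn_Banach_separating_real by blast
  \<comment> \<open>The standard complexification \<open>g(x) - i g(ix)\<close>, the complex linear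
    functional with real part \<open>g\<close>.\<close>
  define f where "f x = Complex (g x) (- g (\<i> *\<^sub>C x))" for x
  note lin = linear_add[OF g(1)] linear_cmul[OF g(1)]
  have add: "f (x + y) = f x + f y" for x y
    by (simp add: f_def lin scaleC_add_right complex_eq_iff)
  have g_scale: "g (c *\<^sub>C x) = Re c * g x + Im c * g (\<i> *\<^sub>C x)" for c x
  proof -
    have "c *\<^sub>C x = Re c *\<^sub>R x + Im c *\<^sub>R \<i> *\<^sub>C x"
      by (simp add: scaleR_scaleC scaleC_scaleC flip: scaleC_add_left)
        (metis complex_eq mult.commute)
    then show ?thesis by (simp add: lin)
  qed
  have scale: "f (c *\<^sub>C x) = c *\<^sub>C f x" for c x
    by (simp add: f_def g_scale[of c] scaleC_scaleC g_scale[of "\<i> * c"] scaleC_complex_def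
        complex_eq_iff)
  have "bounded_linear f"
  proof (rule bounded_linear_intro[of _ 2])
    show "f (x + y) = f x + f y" for x y by (rule add)
    show "f (r *\<^sub>R x) = r *\<^sub>R f x" for r x
      unfolding scaleR_scaleC[of r x] scaleR_scaleC[of r "f x"] by (rule scale)
    show "norm (f x) \<le> norm x * 2" for x
      using cmod_le[of "f x"] g(2)[of x] g(2)[of "\<i> *\<^sub>C x"] by (simp add: f_def norm_scaleC)
  qed
  then have "continuous_clinear_on UNIV f"
    using scale by (rule bounded_linear_imp_continuous_clinear)
  moreover have "f v \<noteq> 0" using assms g(3) by (simp add: f_def complex_eq_iff)
  ultimately show ?thesis using that by blast
qed

section \<open>Vector-valued property B\<close>

text \<open>A functional separating the two sides would violate the scalar-valued property.\<close>

lemma property_B_vector_valued: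
  fixes f :: "'a::complex_banach_algebra \<Rightarrow> 'a \<Rightarrow> 'x::complex_normed_vector"
  assumes B: "property_B TYPE('a)" and f: "continuous_cbilinear f"
    and zero: "\<And>a b. a * b = 0 \<Longrightarrow> f a b = 0"
  shows "f (a * b) c = f a (b * c)"
proof (rule ccontr)
  assume "f (a * b) c \<noteq> f a (b * c)"
  then obtain L :: "'x \<Rightarrow> complex"
    where L: "continuous_clinear_on UNIV L" "L (f (a * b) c - f a (b * c)) \<noteq> 0"
    using Hahn_Banach_separating_complex[of "f (a * b) c - f a (b * c)"] by auto
  interpret L: bounded_linear L by (rule continuous_clinear_imp_bounded_linear[OF L(1)])
  have "L (f (a * b) c) = L (f a (b * c))"
    by (rule B[unfolded property_B_def, rule_format, of "\<lambda>a b. L (f a b)"])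
      (use continuous_clinear_compose_cbilinear[OF L(1) f] zero L.zero in auto)
  then show False using L(2) by (simp add: L.diff)
qed

text \<open>With \<open>c' * d' = 0\<close> fixed, property B in the outer pair moves
  \<open>e'\<close> across. The resulting equation says that \<open>h\<close> vanishes on pairs with
  zero product, so property B applies again, in the inner pair, and moves \<open>f\<close>
  across.\<close>

lemma property_B_triple:
  fixes \<phi> :: "'a::complex_banach_algebra \<Rightarrow> 'a \<Rightarrow> 'x::complex_normed_vector"
  assumes B: "property_B TYPE('a)" and \<phi>: "continuous_cbilinear \<phi>"
    and zero: "\<And>a b. a * b = 0 \<Longrightarrow> b * a = 0 \<Longrightarrow> \<phi> a b = 0"
  shows "\<phi> (b * x * c * f) (d * y * a * e) - \<phi> (e * b * x * c * f) (d * y * a)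
       = \<phi> (b * x * c) (f * d * y * a * e) - \<phi> (e * b * x * c) (f * d * y * a)"
proof -
  have "\<phi> (b' * x * c') (d' * y * (a' * e')) = \<phi> ((e' * b') * x * c') (d' * y * a')"
    if cd: "c' * d' = 0" for a' b' c' d' e'
  proof -
    define g where "g a b = \<phi> (b * (x * c')) (d' * y * a)" for a b
    have "continuous_cbilinear g"
      unfolding g_def
      by (intro continuous_cbilinear_swap[OF continuous_cbilinear_compose[OF \<phi>]]
          continuous_clinear_mult)
    moreover have "g p q = 0" if pq: "p * q = 0" for p q
      unfolding g_def
    proof (rule zero)
      have "q * (x * c') * (d' * y * p) = q * x * (c' * d') * y * p"
        by (simp only: mult.assoc)
      then show "q * (x * c') * (d' * y * p) = 0" by (simp add: cd)
      have "d' * y * p * (q * (x * c')) = d' * y * (p * q) * (x * c')"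
        by (simp only: mult.assoc)
      then show "d' * y * p * (q * (x * c')) = 0" by (simp add: pq)
    qed
    ultimately have "g (a' * e') b' = g a' (e' * b')"
      by (rule property_B_vector_valued[OF B])
    then show ?thesis by (simp add: g_def mult.assoc)
  qed
  note * = this
  define h where
    "h c d = \<phi> (b * x * c) (d * (y * a * e)) - \<phi> (e * b * x * c) (d * (y * a))" for c d
  have "continuous_cbilinear h"
    unfolding h_def
    by (intro continuous_cbilinear_diff continuous_cbilinear_compose[OF \<phi>] continuous_clinear_mult)
  moreover have "h p q = 0" if "p * q = 0" for p q
    using *[OF that, of b a e] by (simp add: h_def mult.assoc)
  ultimately have "h (c * f) d = h c (f * d)"
    by (rule property_B_vector_valued[OF B])
  then show ?thesis by (simp add: h_def mult.assoc)
qed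

section \<open>Approximate diagonals\<close>

lemma continuous_cbilinear_tensor: "continuous_cbilinear tensor"
  by (rule bounded_imp_continuous_cbilinear[OF cbilinear_tensor, of 1]) (simp add: norm_tensor_le)

text \<open>The uniqueness half of the universal property, for the bilinear map that
  \<open>G\<close> induces.\<close>

lemma ptensor_eqI:
  fixes G H :: "('a::complex_normed_vector, 'b::complex_normed_vector) ptensor \<Rightarrow> 'c::complex_banach"
  assumes "continuous_clinear_on UNIV G" "continuous_clinear_on UNIV H"
    and "\<And>a b. G (tensor a b) = H (tensor a b)"
  shows "G U = H U"
  using ptensor_universal[OF continuous_clinear_compose_cbilinear[OF assms(1) continuous_cbilinear_tensor]]
    assms by metis

text \<open>The estimate for the algebraic tensor product extends by density. It is what makes
  bounds uniform along the net, for \<open>mult_map (u i)\<close> and for the operators built from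
  \<open>u i\<close>.\<close>

lemma norm_ptensor_lift_le:
  fixes f :: "'a::complex_normed_vector \<Rightarrow> 'b::complex_normed_vector \<Rightarrow> 'c::complex_banach"
  assumes f: "continuous_cbilinear f" and K: "K \<ge> 0" "\<And>a b. norm (f a b) \<le> K * (norm a * norm b)"
  shows "norm (ptensor_lift f U) \<le> K * norm U"
proof -
  have cb: "cbilinear f" using f by (simp add: continuous_cbilinear_def)
  interpret L: bounded_linear "ptensor_lift f"
    by (rule continuous_clinear_imp_bounded_linear[OF ptensor_lift(1)[OF f]])
  have "ptensor_lift f (ptensor_of (\<Sum>(a, b)\<in>#M. atens a b))
      = atensor_lift f (\<Sum>(a, b)\<in>#M. atens a b)" for M
  proof (induction M)
    case empty
    then show ?case
      using atensor_lift_props(1)[OF cb, of 0 0] by (simp add: ptensor_of_zero L.zero)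
  next
    case (add p M)
    obtain a b where "p = (a, b)" by (cases p)
    then show ?case
      using add ptensor_lift(2)[OF f, of a b]
      by (simp add: ptensor_of_add L.add atensor_lift_props[OF cb] tensor_def)
  qed
  then have eq: "ptensor_lift f (ptensor_of x) = atensor_lift f x" for x
    by (metis atensor_eq_sum)
  obtain v where v: "(\<lambda>n. ptensor_of (v n)) \<longlonglongrightarrow> U" by (rule ptensor_dense)
  show ?thesis
    by (rule tendsto_le[OF _ tendsto_mult_left[OF tendsto_norm[OF v]] tendsto_norm[OF L.tendsto[OF v]]])
      (auto simp: eq norm_ptensor_of atensor_lift_bounded[OF cb K])
qed

lemma norm_mult_map_le:
  fixes U :: "('a::complex_banach_algebra, 'a) ptensor"
  shows "norm (mult_map U) \<le> norm U"
  using norm_ptensor_lift_le[OF continuous_cbilinear_mult, of 1 U]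
  by (simp add: mult_map_def norm_mult_ineq)

lemma mult_map_left_act: "mult_map (left_act a U) = a * mult_map U"
  by (rule ptensor_eqI[OF continuous_clinear_compose[OF mult_map(1) left_act(1)]
        continuous_clinear_compose[OF continuous_clinear_mult(1) mult_map(1)]])
    (simp add: left_act mult_map mult.assoc)

lemma mult_map_right_act: "mult_map (right_act U a) = mult_map U * a"
  by (rule ptensor_eqI[OF continuous_clinear_compose[OF mult_map(1) right_act(1)]
        continuous_clinear_compose[OF continuous_clinear_mult(2) mult_map(1)]])
    (simp add: right_act mult_map mult.assoc)

section \<open>Approximate diagonals as limits along a filter\<close>

text \<open>The filter of tails; it turns net convergence into filter convergence, for which the
  limit laws are available.\<close>

definition net_filter :: "'i set \<Rightarrow> ('i \<Rightarrow> 'i \<Rightarrow> bool) \<Rightarrow> 'i filter" where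
  "net_filter I le = (INF i\<in>I. principal {j\<in>I. le i j})"

lemma eventually_net_filter:
  fixes I :: "'i set"
  assumes I: "directed I le"
  shows "eventually P (net_filter I le) \<longleftrightarrow> (\<exists>i\<in>I. \<forall>j\<in>I. le i j \<longrightarrow> P j)"
proof -
  have dir: "\<exists>k\<in>I. principal {x\<in>I. le k x} \<le> inf (principal {x\<in>I. le i x}) (principal {x\<in>I. le j x})"
    if ij: "i \<in> I" "j \<in> I" for i j
  proof -
    obtain k where k: "k \<in> I" "le i k" "le j k" using directedD(3)[OF I ij] by blast
    have "{x\<in>I. le k x} \<subseteq> {x\<in>I. le i x} \<inter> {x\<in>I. le j x}"
    proof
      fix x assume "x \<in> {x\<in>I. le k x}"
      then have "x \<in> I" "le k x" by auto
      then show "x \<in> {x\<in>I. le i x} \<inter> {x\<in>I. le j x}"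
        using directedD(2)[OF I ij(1) k(1) _ k(2)] directedD(2)[OF I ij(2) k(1) _ k(3)] by blast
    qed
    then show ?thesis using k(1) by (intro bexI[of _ k]) simp_all
  qed
  have "eventually P (net_filter I le) \<longleftrightarrow> (\<exists>i\<in>I. eventually P (principal {j\<in>I. le i j}))"
    unfolding net_filter_def by (rule eventually_INF_base[OF directedD(1)[OF I] dir])
  then show ?thesis unfolding eventually_principal by blast
qed

lemma net_filter_neq_bot:
  fixes I :: "'i set"
  assumes I: "directed I le"
  shows "net_filter I le \<noteq> bot"
proof -
  have "\<forall>i\<in>I. le i i" using I unfolding directed_def by blast
  then show ?thesis
    unfolding trivial_limit_def eventually_net_filter[OF I] by blast
qed

lemma tendsto_net_filter:
  fixes l :: "'a::metric_space"
  shows "directed I le \<Longrightarrow> (f \<longlongrightarrow> l) (net_filter I le) \<longleftrightarrow> net_tendsto I le f l"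
  by (simp add: tendsto_iff net_tendsto_iff eventually_net_filter)

text \<open>The bound holds only eventually, because \<open>u\<close> is a total function whose
  norms are controlled on the index set alone.\<close>

locale approximate_diagonal_filter =
  fixes F :: "'i filter" and u :: "'i \<Rightarrow> ('a::complex_banach_algebra, 'a) ptensor" and C :: real
  assumes nontrivial: "F \<noteq> bot"
    and bounded: "\<forall>\<^sub>F i in F. norm (u i) \<le> C"
    and central: "((\<lambda>i. left_act a (u i) - right_act (u i) a) \<longlongrightarrow> 0) F"
    and unit: "((\<lambda>i. mult_map (u i) * a) \<longlongrightarrow> a) F"
begin

abbreviation e :: "'i \<Rightarrow> 'a" where
  "e i \<equiv> mult_map (u i)"

lemma e_bounded: "\<forall>\<^sub>F i in F. norm (e i) \<le> C"
  by (rule eventually_mono[OF bounded]) (rule norm_mult_map_le[THEN order_trans])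

text \<open>\<open>unit\<close> acts from the left; applying \<open>mult_map\<close> to the
  centrality limit shows that \<open>a * e i - e i * a\<close> tends to 0.\<close>

lemma unit_right: "((\<lambda>i. a * e i) \<longlongrightarrow> a) F"
proof -
  interpret m: bounded_linear "mult_map :: ('a, 'a) ptensor \<Rightarrow> 'a"
    by (rule continuous_clinear_imp_bounded_linear[OF mult_map(1)])
  have "((\<lambda>i. mult_map (left_act a (u i) - right_act (u i) a) + e i * a) \<longlongrightarrow> mult_map 0 + a) F"
    by (intro tendsto_add m.tendsto central unit)
  then show ?thesis by (simp add: m.diff m.zero mult_map_left_act mult_map_right_act)
qed

text \<open>\<open>a * b\<close> is the limit of \<open>a * b * e i\<close>, and then
  \<open>a\<close> is the limit of \<open>a * e i\<close>. Density stands in for factoring every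
  element into three.\<close>

lemma closure_triple_products: "closure {x * y * z |x y z :: 'a. True} = UNIV"
proof -
  let ?S = "{x * y * z |x y z :: 'a. True}"
  have "a * b \<in> closure ?S" for a b
  proof (rule Lim_in_closed_set[OF closed_closure _ nontrivial unit_right])
    show "\<forall>\<^sub>F i in F. a * b * e i \<in> closure ?S"
      by (intro always_eventually allI subsetD[OF closure_subset]) blast
  qed
  then have "\<forall>\<^sub>F i in F. a * e i \<in> closure ?S" for a by simp
  from Lim_in_closed_set[OF closed_closure this nontrivial unit_right]
  show ?thesis by auto
qed

lemma eq_if_eq_on_triple_products:
  fixes h k :: "'a \<Rightarrow> 'b::t2_space"
  assumes "continuous_on UNIV h" "continuous_on UNIV k"
    and "\<And>x y z. h (x * y * z) = k (x * y * z)"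
  shows "h a = k a"
proof -
  have "closed {a. h a = k a}" by (rule closed_Collect_eq[OF assms(1,2)])
  then have "closure {x * y * z |x y z :: 'a. True} \<subseteq> {a. h a = k a}"
    using assms(3) by (intro closure_minimal) auto
  then show ?thesis using closure_triple_products by auto
qed

end

lemma amenable_filter:
  assumes "amenable TYPE('a::complex_banach_algebra)"
  obtains F :: "('a::complex_banach_algebra set \<times> nat) filter" and u C
  where "approximate_diagonal_filter F (u :: _ \<Rightarrow> ('a, 'a) ptensor) C"
proof -
  obtain I le and u :: "'a set \<times> nat \<Rightarrow> ('a, 'a) ptensor" where ad: "approximate_diagonal I le u"
    using assms unfolding amenable_def by blast
  then have I: "directed I le" by (simp add: approximate_diagonal_def)
  obtain C where C: "\<And>i. i \<in> I \<Longrightarrow> norm (u i) \<le> C"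
    using ad unfolding approximate_diagonal_def by blast
  have "approximate_diagonal_filter (net_filter I le) u C"
  proof
    show "net_filter I le \<noteq> bot" by (rule net_filter_neq_bot[OF I])
    show "\<forall>\<^sub>F i in net_filter I le. norm (u i) \<le> C"
      unfolding eventually_net_filter[OF I] using C directedD(1)[OF I] by blast
  qed (use ad in \<open>simp_all add: tendsto_net_filter[OF I] approximate_diagonal_def\<close>)
  then show ?thesis using that by blast
qed

section \<open>The symmetric and antisymmetric parts\<close>

lemma scaleC_half_double: "(1/2) *\<^sub>C (x + x) = x"
  by (simp add: scaleC_add_right scaleC_one flip: scaleC_add_left)

section \<open>Consequences of property B along the approximate identity\<close>

context approximate_diagonal_filter
begin

lemma tendsto_mult_e_mult: "((\<lambda>i. a * e i * b) \<longlongrightarrow> a * b) F"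
  by (intro tendsto_mult_right unit_right)

text \<open>\<open>property_B_triple\<close> is the case where \<open>a\<close> and \<open>c\<close>
  are products of three; density removes this restriction first in \<open>a\<close>, then in
  \<open>c\<close>.\<close>

lemma zero_product_identity:
  fixes \<phi> :: "'a \<Rightarrow> 'a \<Rightarrow> 'x::complex_normed_vector"
  assumes B: "property_B TYPE('a)" and \<phi>: "continuous_cbilinear \<phi>"
    and zero: "\<And>a b. a * b = 0 \<Longrightarrow> b * a = 0 \<Longrightarrow> \<phi> a b = 0"
  shows "\<phi> (a * b) (c * d) - \<phi> (d * a * b) c = \<phi> a (b * c * d) - \<phi> (d * a) (b * c)"
proof -
  interpret \<phi>: bounded_bilinear \<phi> by (rule continuous_cbilinear_imp_bounded_bilinear[OF \<phi>])
  note cont = continuous_intros \<phi>.continuous_on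
  have *: "\<phi> (a * b) (x' * y' * z' * d) - \<phi> (d * a * b) (x' * y' * z')
      = \<phi> a (b * (x' * y' * z') * d) - \<phi> (d * a) (b * (x' * y' * z'))" for x' y' z'
    by (rule eq_if_eq_on_triple_products[where
          h = "\<lambda>a. \<phi> (a * b) (x' * y' * z' * d) - \<phi> (d * a * b) (x' * y' * z')" and
          k = "\<lambda>a. \<phi> a (b * (x' * y' * z') * d) - \<phi> (d * a) (b * (x' * y' * z'))"])
      (use property_B_triple[OF B \<phi> zero, of _ _ _ b x' y' z' d] in
        \<open>simp_all add: mult.assoc, (intro cont)+\<close>)
  show ?thesis
    by (rule eq_if_eq_on_triple_products[where
          h = "\<lambda>c. \<phi> (a * b) (c * d) - \<phi> (d * a * b) c" and
          k = "\<lambda>c. \<phi> a (b * c * d) - \<phi> (d * a) (b * c)"])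
      ((intro cont)+, rule *)
qed

text \<open>Putting \<open>e i\<close> for \<open>c\<close> and \<open>c\<close> for
  \<open>d\<close> in \<open>id\<close> expresses \<open>\<phi> (c * a * b) (e i)\<close> through
  convergent terms. So the limit exists on triple products, with the value stated last, and by the
  uniform bound everywhere.\<close>

lemma limit_functional:
  fixes \<phi> :: "'a \<Rightarrow> 'a \<Rightarrow> 'x::complex_banach"
  assumes \<phi>: "continuous_cbilinear \<phi>"
    and id: "\<And>a b c d. \<phi> (a * b) (c * d) - \<phi> (d * a * b) c = \<phi> a (b * c * d) - \<phi> (d * a) (b * c)"
  obtains \<tau> where "continuous_clinear_on UNIV \<tau>" "\<And>x. ((\<lambda>i. \<phi> x (e i)) \<longlongrightarrow> \<tau> x) F"
    "\<And>a b c. \<phi> (a * b) c + \<phi> (c * a) b = \<tau> (c * a * b) + \<phi> a (b * c)"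
proof -
  interpret \<phi>: bounded_bilinear \<phi> by (rule continuous_cbilinear_imp_bounded_bilinear[OF \<phi>])
  obtain K where K: "K \<ge> 0" "\<And>a b. norm (\<phi> a b) \<le> K * (norm a * norm b)"
    using continuous_cbilinear_bounded[OF \<phi>] by blast
  have lim: "((\<lambda>i. \<phi> (c * a * b) (e i)) \<longlongrightarrow> \<phi> (a * b) c - \<phi> a (b * c) + \<phi> (c * a) b) F" for a b c
  proof -
    have "\<phi> (c * a * b) (e i) = \<phi> (a * b) (e i * c) - \<phi> a (b * e i * c) + \<phi> (c * a) (b * e i)" for i
      using id[of a b "e i" c] by (simp add: algebra_simps)
    then show ?thesis
      by (auto intro!: tendsto_intros \<phi>.tendsto unit unit_right tendsto_mult_e_mult)
  qed
  have bound: "\<forall>\<^sub>F i in F. \<forall>x. norm (\<phi> x (e i)) \<le> (K * C) * norm x"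
    using e_bounded
  proof eventually_elim
    case (elim i)
    show ?case
    proof
      fix x
      have "norm (\<phi> x (e i)) \<le> K * (norm x * norm (e i))" by (rule K(2))
      also have "\<dots> \<le> K * (norm x * C)" using elim K(1) by (intro mult_left_mono) auto
      finally show "norm (\<phi> x (e i)) \<le> (K * C) * norm x" by (simp add: mult_ac)
    qed
  qed
  have "\<exists>l. ((\<lambda>i. \<phi> x (e i)) \<longlongrightarrow> l) F" for x
    by (rule operator_limit_closure[OF nontrivial \<phi>.diff_left bound,
          where S = "{x * y * z |x y z. True}"])
      (use lim closure_triple_products in auto)
  then obtain \<tau> where \<tau>: "\<And>x. ((\<lambda>i. \<phi> x (e i)) \<longlongrightarrow> \<tau> x) F" by metis
  have "continuous_clinear_on UNIV (\<lambda>x. \<phi> x (e i))" for i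
    by (rule bounded_linear_imp_continuous_clinear[OF \<phi>.bounded_linear_left])
      (rule continuous_cbilinear_scaleC[OF \<phi>])
  then have "continuous_clinear_on UNIV \<tau>"
    by (rule continuous_clinear_operator_limit[OF nontrivial _ bound]) (simp_all add: \<tau>)
  moreover have "\<phi> (a * b) c + \<phi> (c * a) b = \<tau> (c * a * b) + \<phi> a (b * c)" for a b c
    using tendsto_unique[OF nontrivial \<tau> lim[of c a b]] by simp
  ultimately show ?thesis using that \<tau> by blast
qed

text \<open>The identity with \<open>a = e i\<close>, solved for the term whose first argument is
  \<open>e i\<close> alone.\<close>

lemma limit_functional_swap:
  fixes \<phi> :: "'a \<Rightarrow> 'a \<Rightarrow> 'x::complex_banach"
  assumes \<phi>: "continuous_cbilinear \<phi>"
    and \<tau>: "continuous_clinear_on UNIV \<tau>"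
    and id: "\<And>a b c. \<phi> (a * b) c + \<phi> (c * a) b = \<tau> (c * a * b) + \<phi> a (b * c)"
  shows "((\<lambda>i. \<phi> (e i) (b * c)) \<longlongrightarrow> \<phi> b c + \<phi> c b - \<tau> (c * b)) F"
proof -
  interpret \<phi>: bounded_bilinear \<phi> by (rule continuous_cbilinear_imp_bounded_bilinear[OF \<phi>])
  interpret \<tau>: bounded_linear \<tau> by (rule continuous_clinear_imp_bounded_linear[OF \<tau>])
  have "\<phi> (e i) (b * c) = \<phi> (e i * b) c + \<phi> (c * e i) b - \<tau> (c * e i * b)" for i
    using id[of "e i" b c] by (simp add: algebra_simps)
  then show ?thesis
    by (auto intro!: tendsto_intros \<phi>.tendsto \<tau>.tendsto unit unit_right tendsto_mult_e_mult)
qed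

section \<open>The symmetric part\<close>

text \<open>By symmetry the limit in \<open>limit_functional_swap\<close> is also
  \<open>\<tau> (b * c)\<close>; equating the two gives twice \<open>\<phi> b c\<close> as
  \<open>\<tau>\<close> of the Jordan product.\<close>

lemma symmetric_form:
  fixes \<phi> :: "'a \<Rightarrow> 'a \<Rightarrow> 'x::complex_banach"
  assumes B: "property_B TYPE('a)" and \<phi>: "continuous_cbilinear \<phi>"
    and zero: "\<And>a b. a * b = 0 \<Longrightarrow> b * a = 0 \<Longrightarrow> \<phi> a b = 0"
    and sym: "\<And>a b. \<phi> a b = \<phi> b a"
  obtains \<Psi> where "continuous_clinear_on UNIV \<Psi>" "\<And>a b. \<phi> a b = \<Psi> (jordan_product a b)"
proof -
  obtain \<tau> where \<tau>: "continuous_clinear_on UNIV \<tau>" "\<And>x. ((\<lambda>i. \<phi> x (e i)) \<longlongrightarrow> \<tau> x) F"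
    "\<And>a b c. \<phi> (a * b) c + \<phi> (c * a) b = \<tau> (c * a * b) + \<phi> a (b * c)"
    using limit_functional[OF \<phi> zero_product_identity[OF B \<phi> zero]] by blast
  interpret \<tau>: bounded_linear \<tau> by (rule continuous_clinear_imp_bounded_linear[OF \<tau>(1)])
  have "\<phi> b c = (1/2) *\<^sub>C \<tau> (jordan_product b c)" for b c
  proof -
    have "((\<lambda>i. \<phi> (e i) (b * c)) \<longlongrightarrow> \<tau> (b * c)) F"
      using \<tau>(2)[of "b * c"] by (simp add: sym)
    from tendsto_unique[OF nontrivial this limit_functional_swap[OF \<phi> \<tau>(1,3)]]
    have "\<tau> (jordan_product b c) = \<phi> b c + \<phi> c b" by (simp add: jordan_product_def \<tau>.add)
    then show ?thesis unfolding sym[of c b] by (simp only: scaleC_half_double)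
  qed
  moreover have "continuous_clinear_on UNIV (\<lambda>x. (1/2) *\<^sub>C \<tau> x)"
    by (rule continuous_clinear_on_scaleC[OF \<tau>(1)])
  ultimately show ?thesis using that[of "\<lambda>x. (1/2) *\<^sub>C \<tau> x"] by blast
qed

section \<open>Derivations and the antisymmetric part\<close>

text \<open>The identity for \<^term>\<open>D\<close> says that \<open>a \<mapsto> D a\<close> is a derivation into the dual bimodule; this is
  Johnson's argument that such derivations are inner.  The functional obtained in the bidual
  converges in \<open>X\<close> itself on commutators, because its values there are those of \<^term>\<open>D\<close>.\<close>

lemma derivation_inner:
  fixes D :: "'a \<Rightarrow> 'a \<Rightarrow> 'x::complex_banach"
  assumes D: "continuous_cbilinear D"
    and der: "\<And>a b c. D (a * b) c = D a (b * c) + D b (c * a)"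
  obtains \<Phi> where "continuous_clinear_on commutator_span \<Phi>" "\<And>a b. D a b = \<Phi> (commutator a b)"
proof -
  interpret D: bounded_bilinear D by (rule continuous_cbilinear_imp_bounded_bilinear[OF D])
  \<comment> \<open>Formally, \<open>T i c\<close> is minus the sum of \<open>D y (c * x)\<close>
    over the elementary tensors \<open>tensor x y\<close> that make up \<open>u i\<close>.\<close>
  define g where "g c x y = - D y (c * x)" for c x y
  define T where "T i c = ptensor_lift (g c) (u i)" for i c
  have g: "continuous_cbilinear (g c)" for c
    unfolding g_def
    \<comment> \<open>\<open>D - D\<close> supplies the zero map, so that the negative is obtained
      as a difference.\<close>
    using continuous_cbilinear_diff[OF continuous_cbilinear_diff[OF D D]
        continuous_cbilinear_swap[OF continuous_cbilinear_compose[OF D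
            bounded_linear_imp_continuous_clinear[OF bounded_linear_ident] continuous_clinear_mult(1)]]]
    by simp
  note G = ptensor_lift(1)[OF g]
  obtain K where K: "K \<ge> 0" "\<And>a b. norm (D a b) \<le> K * (norm a * norm b)"
    using continuous_cbilinear_bounded[OF D] by blast
  have g_bound: "norm (g c x y) \<le> (K * norm c) * (norm x * norm y)" for c x y
  proof -
    have "norm (g c x y) \<le> K * (norm y * norm (c * x))" by (simp add: g_def K)
    also have "\<dots> \<le> K * (norm y * (norm c * norm x))"
      using K(1) by (intro mult_left_mono norm_mult_ineq) auto
    finally show ?thesis by (simp add: mult_ac)
  qed
  have T_bound: "norm (T i c) \<le> K * norm c * norm (u i)" for i c
    unfolding T_def by (rule norm_ptensor_lift_le[OF g _ g_bound]) (simp add: K)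
  have T: "continuous_clinear_on UNIV (T i)" for i
  proof (rule bounded_linear_imp_continuous_clinear)
    have add: "T i (c + c') = T i c + T i c'" for c c'
      unfolding T_def
      by (rule ptensor_eqI[OF G continuous_clinear_add[OF G G]])
        (simp add: ptensor_lift(2)[OF g] g_def distrib_right D.add_right)
    show scale: "T i (s *\<^sub>C c) = s *\<^sub>C T i c" for s c
      unfolding T_def
      by (rule ptensor_eqI[OF G continuous_clinear_on_scaleC[OF G]])
        (simp add: ptensor_lift(2)[OF g] g_def mult_scaleC_left continuous_cbilinear_scaleC[OF D])
    show "bounded_linear (T i)"
      by (rule bounded_linear_intro[of _ "K * norm (u i)"])
        (use add scale T_bound in \<open>simp_all add: scaleR_scaleC mult_ac\<close>)
  qed
  have bound: "\<forall>\<^sub>F i in F. \<forall>c. norm (T i c) \<le> (K * C) * norm c"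
    using bounded
  proof eventually_elim
    case (elim i)
    show ?case
    proof
      fix c
      have "norm (T i c) \<le> K * norm c * norm (u i)" by (rule T_bound)
      also have "K * norm c * norm (u i) \<le> K * norm c * C"
        using elim K(1) by (intro mult_left_mono) auto
      finally show "norm (T i c) \<le> (K * C) * norm c" by (simp add: mult_ac)
    qed
  qed
  have lim: "((\<lambda>i. T i (commutator a c)) \<longlongrightarrow> D a c) F" for a c
  proof -
    interpret L: bounded_linear "ptensor_lift (g c)"
      by (rule continuous_clinear_imp_bounded_linear[OF G])
    have left: "ptensor_lift (g (c * a)) U = ptensor_lift (g c) (left_act a U)" for U
      by (rule ptensor_eqI[OF G continuous_clinear_compose[OF G left_act(1)]])
        (simp add: ptensor_lift(2)[OF g] left_act g_def mult.assoc)
    have "continuous_clinear_on UNIV (D a)"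
      by (rule bounded_linear_imp_continuous_clinear[OF D.bounded_linear_right])
        (rule continuous_cbilinear_scaleC[OF D])
    then have Dc: "continuous_clinear_on UNIV (\<lambda>U. D a (c * mult_map U))"
      by (rule continuous_clinear_compose[OF _ continuous_clinear_compose[OF
              continuous_clinear_mult(1) mult_map(1)]])
    \<comment> \<open>The derivation identity for \<open>D (y * a) (c * x)\<close> enters here:
      moving \<open>a\<close> past \<open>y\<close> costs \<open>D a (c * x * y)\<close>, and
      \<open>mult_map\<close> collects the products \<open>x * y\<close>.\<close>
    have right: "ptensor_lift (g (a * c)) U = ptensor_lift (g c) (right_act U a) + D a (c * mult_map U)" for U
      by (rule ptensor_eqI[OF G continuous_clinear_add[OF continuous_clinear_compose[OF G right_act(1)] Dc]])
        (simp add: ptensor_lift(2)[OF g] right_act mult_map g_def der mult.assoc)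
    have "T i (commutator a c)
        = D a (c * e i) - ptensor_lift (g c) (left_act a (u i) - right_act (u i) a)" for i
    proof -
      have "T i (commutator a c) = T i (a * c) - T i (c * a)"
        unfolding commutator_def by (rule linear_diff[OF bounded_linear.linear[OF
                continuous_clinear_imp_bounded_linear[OF T]]])
      then show ?thesis by (simp add: T_def left right L.diff)
    qed
    \<comment> \<open>The lift is applied to the centrality defect of \<open>u i\<close>, which
      tends to 0, while \<open>c * e i\<close> tends to \<open>c\<close>.\<close>
    moreover have "((\<lambda>i. D a (c * e i) - ptensor_lift (g c) (left_act a (u i) - right_act (u i) a))
        \<longlongrightarrow> D a c - ptensor_lift (g c) 0) F"
      by (intro tendsto_diff D.tendsto L.tendsto tendsto_const unit_right central)
    ultimately show ?thesis by (simp add: L.zero)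
  qed
  \<comment> \<open>As each \<open>T i\<close> is linear, the points of convergence form a subspace,
    and it contains the commutators.\<close>
  have "\<exists>l. ((\<lambda>i. T i x) \<longlongrightarrow> l) F" if "x \<in> commutator_span" for x
    using that unfolding commutator_span_def
  proof (rule complex_vector.span_induct[where P = "\<lambda>x. \<exists>l. ((\<lambda>i. T i x) \<longlongrightarrow> l) F"])
    have T_add: "T i (x + y) = T i x + T i y" and T_scale: "T i (s *\<^sub>C x) = s *\<^sub>C T i x" for i s x y
      using T[of i] unfolding continuous_clinear_on_def by blast+
    have T_zero: "T i 0 = 0" for i using T_add[of i 0 0] by simp
    show "complex_vector.subspace {x. \<exists>l. ((\<lambda>i. T i x) \<longlongrightarrow> l) F}"
      by (rule complex_vector.subspaceI)
        (auto simp: T_add T_scale T_zero intro: tendsto_add tendsto_scaleC)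
  qed (use lim in blast)
  then obtain \<Phi> where \<Phi>: "\<And>x. x \<in> commutator_span \<Longrightarrow> ((\<lambda>i. T i x) \<longlongrightarrow> \<Phi> x) F" by metis
  have "continuous_clinear_on commutator_span \<Phi>"
    by (rule continuous_clinear_operator_limit[OF nontrivial T bound _ \<Phi>])
      (simp add: commutator_span_def complex_vector.subspace_span)
  moreover have "D a b = \<Phi> (commutator a b)" for a b
  proof (rule tendsto_unique[OF nontrivial lim \<Phi>])
    show "commutator a b \<in> commutator_span"
      unfolding commutator_span_def by (rule complex_vector.span_base) blast
  qed
  ultimately show ?thesis using that by blast
qed

text \<open>The limit of \<open>\<phi> (e i) (b * a)\<close> is \<open>- \<tau> (b * a)\<close> by
  antisymmetry and \<open>- \<tau> (a * b)\<close> by \<open>limit_functional_swap\<close>, so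
  \<open>\<tau>\<close> is a trace.\<close>

lemma antisymmetric_form:
  fixes \<phi> :: "'a \<Rightarrow> 'a \<Rightarrow> 'x::complex_banach"
  assumes B: "property_B TYPE('a)" and \<phi>: "continuous_cbilinear \<phi>"
    and zero: "\<And>a b. a * b = 0 \<Longrightarrow> b * a = 0 \<Longrightarrow> \<phi> a b = 0"
    and antisym: "\<And>a b. \<phi> a b = - \<phi> b a"
  obtains \<Phi> where "continuous_clinear_on commutator_span \<Phi>" "\<And>a b. \<phi> a b = \<Phi> (commutator a b)"
proof -
  obtain \<tau> where \<tau>: "continuous_clinear_on UNIV \<tau>" "\<And>x. ((\<lambda>i. \<phi> x (e i)) \<longlongrightarrow> \<tau> x) F"
    "\<And>a b c. \<phi> (a * b) c + \<phi> (c * a) b = \<tau> (c * a * b) + \<phi> a (b * c)"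
    using limit_functional[OF \<phi> zero_product_identity[OF B \<phi> zero]] by blast
  have trace: "\<tau> (a * b) = \<tau> (b * a)" for a b
  proof -
    have "((\<lambda>i. \<phi> (e i) (b * a)) \<longlongrightarrow> - \<tau> (b * a)) F"
      unfolding antisym[of "e _" "b * a"] by (intro tendsto_minus \<tau>(2))
    from tendsto_unique[OF nontrivial this limit_functional_swap[OF \<phi> \<tau>(1,3)]]
    show ?thesis using antisym[of a b] by simp
  qed
  \<comment> \<open>Adding this term turns the identity of \<open>limit_functional\<close> into the
    derivation law: by the trace property all the \<open>\<tau>\<close> terms become multiples of
    \<open>\<tau> (a * b * c)\<close>.\<close>
  define D where "D a b = \<phi> a b + \<tau> (a * b)" for a b
  have D: "continuous_cbilinear D"
    unfolding D_def
    by (rule continuous_cbilinear_add[OF \<phi>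
          continuous_clinear_compose_cbilinear[OF \<tau>(1) continuous_cbilinear_mult]])
  have "D (a * b) c = D a (b * c) + D b (c * a)" for a b c
  proof -
    have "\<phi> (a * b) c = \<tau> (c * a * b) + \<phi> a (b * c) - \<phi> (c * a) b"
      using \<tau>(3)[of a b c] by (simp add: eq_diff_eq)
    moreover have "\<tau> (c * a * b) = \<tau> (a * b * c)" "\<tau> (b * (c * a)) = \<tau> (a * b * c)"
      "\<tau> (a * (b * c)) = \<tau> (a * b * c)"
      using trace[of c "a * b"] trace[of "c * a" b] by (simp_all only: mult.assoc)
    ultimately show ?thesis by (simp add: D_def antisym[of "c * a" b])
  qed
  then obtain \<Phi> where \<Phi>: "continuous_clinear_on commutator_span \<Phi>" "\<And>a b. D a b = \<Phi> (commutator a b)"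
    using derivation_inner[OF D] by blast
  \<comment> \<open>\<open>D\<close> depends linearly on the commutator, hence is antisymmetric like
    \<open>\<phi>\<close>; their difference \<open>\<tau> (a * b)\<close> is then antisymmetric, but
    it is symmetric as well.\<close>
  have "\<tau> (a * b) = 0" for a b
  proof -
    have "commutator a b \<in> commutator_span"
      unfolding commutator_span_def by (rule complex_vector.span_base) blast
    moreover have "commutator b a = (-1) *\<^sub>C commutator a b"
      by (simp add: commutator_def)
    ultimately have "\<Phi> (commutator b a) = (-1) *\<^sub>C \<Phi> (commutator a b)"
      using \<Phi>(1) unfolding continuous_clinear_on_def by metis
    then have "D b a = - D a b" by (simp add: \<Phi>(2))
    then have "\<tau> (a * b) + \<tau> (a * b) = 0"
      unfolding D_def antisym[of b a] trace[of b a] by (simp add: algebra_simps eq_neg_iff_add_eq_0)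
    then show ?thesis by (simp flip: scaleR_2)
  qed
  then show ?thesis using that \<Phi> by (simp add: D_def)
qed

end

theorem theorem4p3:
  fixes \<phi> :: "'a::complex_banach_algebra \<Rightarrow> 'a \<Rightarrow> 'x::complex_banach"
  assumes "amenable TYPE('a)"
    and "property_B TYPE('a)"
    and "continuous_cbilinear \<phi>"
    and "\<And>a b. a * b = 0 \<Longrightarrow> b * a = 0 \<Longrightarrow> \<phi> a b = 0"
  shows "\<exists>(\<Phi> :: 'a \<Rightarrow> 'x) (\<Psi> :: 'a \<Rightarrow> 'x).
    continuous_clinear_on commutator_span \<Phi> \<and>
    continuous_clinear_on UNIV \<Psi> \<and>
    (\<forall>a b. \<phi> a b = \<Phi> (commutator a b) + \<Psi> (jordan_product a b))"
proof -
  obtain F :: "('a set \<times> nat) filter" and u :: "_ \<Rightarrow> ('a, 'a) ptensor" and C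
    where "approximate_diagonal_filter F u C"
    using amenable_filter[OF assms(1)] .
  then interpret approximate_diagonal_filter F u C .
  note swap = continuous_cbilinear_swap[OF assms(3)]
  \<comment> \<open>The condition \<open>ab = ba = 0\<close> is symmetric in \<open>a\<close> and
    \<open>b\<close>, so both parts of \<open>\<phi>\<close> inherit the hypothesis.\<close>
  have "\<phi> a b + \<phi> b a = 0" "\<phi> a b - \<phi> b a = 0" if "a * b = 0" "b * a = 0" for a b
    by (simp_all add: assms(4)[OF that] assms(4)[OF that(2,1)])
  note zero = this
  obtain \<Psi> where \<Psi>: "continuous_clinear_on UNIV \<Psi>"
    "\<And>a b. \<phi> a b + \<phi> b a = \<Psi> (jordan_product a b)"
    using symmetric_form[OF assms(2) continuous_cbilinear_add[OF assms(3) swap] zero(1) add.commute]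
    by blast
  have "\<phi> a b - \<phi> b a = - (\<phi> b a - \<phi> a b)" for a b by simp
  from antisymmetric_form[OF assms(2) continuous_cbilinear_diff[OF assms(3) swap] zero(2) this]
  obtain \<Phi> where \<Phi>: "continuous_clinear_on commutator_span \<Phi>"
    "\<And>a b. \<phi> a b - \<phi> b a = \<Phi> (commutator a b)"
    by blast
  \<comment> \<open>The sum and the difference were taken without the factor 1/2, which is restored
    here.\<close>
  have "\<phi> a b = (1/2) *\<^sub>C \<Phi> (commutator a b) + (1/2) *\<^sub>C \<Psi> (jordan_product a b)" for a b
  proof -
    have "(1/2) *\<^sub>C \<Phi> (commutator a b) + (1/2) *\<^sub>C \<Psi> (jordan_product a b)
        = (1/2) *\<^sub>C (\<phi> a b + \<phi> a b)"
      by (simp flip: \<Phi>(2) \<Psi>(2) scaleC_add_right)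
    then show ?thesis by (simp only: scaleC_half_double)
  qed
  then show ?thesis
    using continuous_clinear_on_scaleC[OF \<Phi>(1), of "1/2"] continuous_clinear_on_scaleC[OF \<Psi>(1), of "1/2"]
    by blast
qed

end
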